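(* Fix $1<p<\infty$. For $r,s>0$ let $$N(r,s)=\#\{(j,k)\in\mathbb{N}\times\mathbb{N}: (js)^p+(ks^{-1})^p\le r^p\},$$ and let $S(r)=\operatorname{arg\,max}_{s>0}N(r,s)$. Then the $p$-ellipse containing the maximum number of positive-integer lattice points approaches a $p$-circle as $r\to\infty$, with $$S(r)\subset\big[1-O(r^{-e}),\,1+O(r^{-e})\big],\qquad e=\min\Big\{\frac16,\frac1{2p}\Big\};$$ that is, there exist $C,r_0>0$ such that $|s-1|\le Cr^{-e}$ for all $r\ge r_0$ and all $s\in S(r)$.
   Context: $\mathbb{N}=\{1,2,3,\dots\}$. $N(r,s)$ is the number of positive-integer lattice points in the $p$-ellipse $|sx|^p+|s^{-1}y|^p\le r^p$; the case $s=1$ is a $p$-circle. For each $r>0$ the function $s\mapsto N(r,s)$ attains its maximum over $s>0$, and $S(r)$ denotes the set of all maximizing values of $s$. *)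

theory Defs
  imports "HOL-Analysis.Analysis"
begin

text \<open>The natural numbers of the paper start at 1, hence the guards on \<open>j\<close> and \<open>k\<close>.\<close>

definition ellipse_points :: "real \<Rightarrow> real \<Rightarrow> real \<Rightarrow> (nat \<times> nat) set" where
  "ellipse_points p r s =
     {(j, k). 1 \<le> j \<and> 1 \<le> k \<and>
        (real j * s) powr p + (real k * inverse s) powr p \<le> r powr p}"

definition lattice_count :: "real \<Rightarrow> real \<Rightarrow> real \<Rightarrow> nat" where
  "lattice_count p r s = card (ellipse_points p r s)"

definition optimal_stretches :: "real \<Rightarrow> real \<Rightarrow> real set" where
  "optimal_stretches p r = {s. is_arg_max (lattice_count p r) (\<lambda>s. 0 < s) s}"

text \<open>For the relevant parameters the cardinality is that of a finite set, and the maximum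
  over all \<open>s > 0\<close> is attained.\<close>

lemma ellipse_points_subset:
  assumes "0 < p" "0 < r" "0 < s"
  shows "ellipse_points p r s \<subseteq> {..nat \<lfloor>r\<^sup>2\<rfloor>} \<times> {..nat \<lfloor>r\<^sup>2\<rfloor>}"
proof (clarsimp simp: ellipse_points_def)
  fix j k :: nat
  assume jk: "Suc 0 \<le> j" "Suc 0 \<le> k"
    and le: "(real j * s) powr p + (real k * inverse s) powr p \<le> r powr p"
  have "(real j * s) powr p \<le> r powr p"
    using le powr_ge_zero[of "real k * inverse s" p] by linarith
  then have js: "real j * s \<le> r"
    using assms by (metis linorder_not_less powr_less_mono2 less_imp_le)
  have "(real k * inverse s) powr p \<le> r powr p"
    using le powr_ge_zero[of "real j * s" p] by linarith
  then have ks: "real k * inverse s \<le> r"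
    using assms by (metis linorder_not_less powr_less_mono2 less_imp_le)
  have "(real j * s) * (real k * inverse s) \<le> r * r"
    using js ks assms by (intro mult_mono) auto
  then have "real j * real k \<le> r\<^sup>2"
    using assms by (simp add: power2_eq_square field_simps)
  then have *: "real (j * k) \<le> r\<^sup>2" by simp
  have "j \<le> j * k" "k \<le> j * k" using jk by auto
  then have "real j \<le> r\<^sup>2" "real k \<le> r\<^sup>2"
    using * by (meson of_nat_mono order_trans)+
  then show "j \<le> nat \<lfloor>r\<^sup>2\<rfloor> \<and> k \<le> nat \<lfloor>r\<^sup>2\<rfloor>"
    by (simp add: le_nat_floor)
qed

lemma finite_ellipse_points:
  assumes "0 < p" "0 < r" "0 < s"
  shows "finite (ellipse_points p r s)"
  using finite_subset[OF ellipse_points_subset[OF assms]] by simp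

lemma optimal_stretches_nonempty:
  assumes "0 < p" "0 < r"
  shows "optimal_stretches p r \<noteq> {}"
proof -
  let ?B = "{..nat \<lfloor>r\<^sup>2\<rfloor>} \<times> {..nat \<lfloor>r\<^sup>2\<rfloor>}"
  have "\<forall>s. 0 < s \<longrightarrow> lattice_count p r s < Suc (card ?B)"
    using card_mono[OF _ ellipse_points_subset[OF assms]]
    unfolding lattice_count_def less_Suc_eq_le by (meson finite_SigmaI finite_atMost)
  then obtain s where "0 < s" "\<forall>t. 0 < t \<longrightarrow> lattice_count p r t \<le> lattice_count p r s"
    using ex_has_greatest_nat[of "\<lambda>s. 0 < s" 1 "lattice_count p r" "Suc (card ?B)"]
    by (auto intro: less_imp_le)
  then show ?thesis
    by (auto simp: optimal_stretches_def is_arg_max_linorder)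
qed

end

theory Submission
  imports Defs
begin

text \<open>The number of lattice points of the stretched \<open>p\<close>-ellipse satisfies
\<open>N(r,s) = A r\<^sup>2 - r (s + 1/s) / 2 + O(r powr (1 - 2 e))\<close>, uniformly for \<open>s\<close> in a compact subset of
\<open>(0,\<infinity>)\<close>, where \<open>A\<close> is the area of the unit quarter \<open>p\<close>-disc (\<open>lattice_count_asymptotic\<close>). The second term is
the cost of leaving out the points on the axes, and it is smallest at \<open>s = 1\<close>. Comparing a maximizer \<open>s\<close>
with \<open>s = 1\<close> gives \<open>(s - 1)\<^sup>2 / s = s + 1/s - 2 = O(r powr (- 2 e))\<close>, which is the claim. Maximizers do stay in
a compact set: by concavity, the points of an ellipse elongated by a factor \<open>s\<close> fall short of its area by at
least a constant times \<open>r s\<close> (\<open>lattice_count_elongated\<close>, \<open>optimal_stretch_bounded\<close>).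

The error term is the heart of the matter. The ellipse is cut at the point of its boundary that comes from the
diagonal point of the unit \<open>p\<close>-circle; below each of the two arcs the points are counted by columns, and the rounding of the column
heights contributes a sum of the sawtooth function \<open>sawtooth\<close> along a concave function. Such sums are bounded
in the manner of van der Corput (\<open>sawtooth_sum_concave\<close>): if the second derivative has size at least \<open>\<mu>\<close>, where \<open>\<mu> \<le> 1\<close>, and the first
derivative varies by \<open>T\<close>, then the sum is \<open>O(T \<mu> powr (-2/3) + \<mu> powr (-1/2))\<close>. The sawtooth is bounded from both
sides by its averages over intervals of length \<open>1/H\<close>. These averages are increments of the periodic second Bernoulli
polynomial, whose absolutely convergent Fourier series (\<open>bernoulli2_fourier\<close>) turns the sum into exponential sums,
and these are controlled by the Kusmin-Landau inequality (\<open>kusmin_landau_unit\<close>, \<open>second_difference_test\<close>).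

The second derivative of the arc at abscissa \<open>\<tau>\<close> behaves like \<open>\<tau> powr (p - 2) / r\<close> and degenerates on the
axis. The arc is therefore cut into octaves (\<open>arc_octave_sawtooth\<close>), of which about \<open>log 2 (r powr (1/p))\<close> are used; the
remaining \<open>O(r powr (1 - 1/p))\<close> columns next to the axis are estimated trivially. The octaves add up to
\<open>O(r powr (2/3) + r powr (1 - 1/p))\<close> (\<open>arc_sawtooth_sum\<close>), which is where the exponent \<open>e\<close> comes from.\<close>

section \<open>Exponential sums with monotone differences\<close>

lemma cot_diff_eq:
  fixes a b :: real
  assumes "sin a \<noteq> 0" "sin b \<noteq> 0"
  shows "cot a - cot b = sin (b - a) / (sin a * sin b)"
  using assms by (simp add: cot_def sin_diff field_simps)

lemma cot_antimono:
  fixes a b :: real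
  assumes "0 < a" "a \<le> b" "b < pi"
  shows "cot b \<le> cot a"
proof -
  have s: "sin a > 0" "sin b > 0" "sin (b - a) \<ge> 0"
    using assms by (auto intro!: sin_gt_zero sin_ge_zero)
  then have "cot a - cot b = sin (b - a) / (sin a * sin b)"
    by (intro cot_diff_eq) auto
  also have "\<dots> \<ge> 0" using s by simp
  finally show ?thesis by simp
qed

lemma sin_pi_ge_self:
  fixes y :: real
  assumes "0 \<le> y" "y \<le> 1/2"
  shows "y \<le> sin (pi * y)"
proof (cases "y \<le> 1/3")
  case True
  show ?thesis
  proof (cases "y = 0")
    case False
    then have "0 < pi * y" using assms by simp
    from MVT2[OF this, of sin cos] obtain z where
      z: "0 < z" "z < pi * y" "sin (pi * y) = pi * y * cos z"
      by (auto intro: DERIV_sin)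
    have "z \<le> pi / 3" using z(2) mult_left_mono[OF True pi_ge_zero] by linarith
    then have "cos z \<ge> cos (pi/3)"
      using z(1) by (intro cos_monotone_0_pi_le) auto
    then have "cos z \<ge> 1/2" by (simp add: cos_60)
    then have "pi * y * cos z \<ge> 2 * y * (1/2)"
      using assms pi_ge_two by (intro mult_mono) auto
    then show ?thesis using z by simp
  qed simp
next
  case False
  have "sin (pi/6) \<le> sin (pi * y)"
    using False assms by (intro sin_monotone_2pi_le) (auto simp: field_simps)
  then show ?thesis using assms by (simp add: sin_30)
qed

lemma sin_pi_ge_margin:
  fixes y :: real
  assumes "\<theta> \<le> y" "y \<le> 1 - \<theta>" "0 \<le> \<theta>" "\<theta> \<le> 1/2"
  shows "\<theta> \<le> sin (pi * y)"
proof (cases "y \<le> 1/2")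
  case True then show ?thesis using sin_pi_ge_self[of y] assms by linarith
next
  case False
  have "sin (pi * y) = sin (pi * (1 - y))"
    using sin_pi_minus[of "pi * y"] by (simp add: algebra_simps)
  then show ?thesis using sin_pi_ge_self[of "1 - y"] assms False by linarith
qed

text \<open>The coefficient \<open>1 / (1 - cis (2 t))\<close> has constant real part, so that its variation is that of the
  cotangent, which is monotone.\<close>

lemma geometric_coefficient:
  fixes t :: real
  assumes "sin t \<noteq> 0"
  shows "Complex (1/2) (cot t / 2) * (1 - cis (2 * t)) = 1"
proof -
  have 1: "cos (2*t) = 1 - 2 * (sin t)\<^sup>2" by (simp add: cos_double_sin)
  have 2: "sin (2*t) = 2 * sin t * cos t" by (simp add: sin_double)
  have 3: "sin t * sin t + cos t * cos t = 1" by (simp add: flip: power2_eq_square)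
  have c: "cot t * sin t = cos t" using assms by (simp add: cot_def)
  have "Re (Complex (1/2) (cot t / 2) * (1 - cis (2 * t))) = sin t * sin t + (cot t * sin t) * cos t"
    by (simp add: 1 2 power2_eq_square)
  moreover have "Im (Complex (1/2) (cot t / 2) * (1 - cis (2 * t))) = (cot t * sin t) * sin t - sin t * cos t"
    by (simp add: 1 2 power2_eq_square)
  ultimately show ?thesis using 3 by (simp add: complex_eq_iff c)
qed

lemma abel_summation:
  fixes c z :: "nat \<Rightarrow> 'a::comm_ring_1"
  shows "(\<Sum>n<Suc N. c n * (z n - z (Suc n))) =
    c 0 * z 0 - c N * z (Suc N) + (\<Sum>n<N. (c (Suc n) - c n) * z (Suc n))"
  by (induction N) (auto simp: algebra_simps)

text \<open>The Kusmin-Landau inequality. With the coefficients above, each term is \<open>c n * (z n - z (Suc n))\<close>. After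
summation by parts only the total variation of \<open>c\<close> matters, and it telescopes because the
differences of \<open>x\<close>, hence their cotangents, are monotone.\<close>

lemma kusmin_landau_unit:
  fixes x :: "nat \<Rightarrow> real"
  assumes \<theta>: "0 < \<theta>" "\<theta> \<le> 1/2"
    and lo: "\<And>n. n < N \<Longrightarrow> \<theta> \<le> x (Suc n) - x n"
    and hi: "\<And>n. n < N \<Longrightarrow> x (Suc n) - x n \<le> 1 - \<theta>"
    and mono: "\<And>n. Suc n < N \<Longrightarrow> x (Suc n) - x n \<le> x (Suc (Suc n)) - x (Suc n)"
  shows "cmod (\<Sum>n<N. cis (2 * pi * x n)) \<le> 3 / \<theta>"
proof (cases N)
  case 0 then show ?thesis using \<theta> by simp
next
  case (Suc M)
  define d where "d n = x (Suc n) - x n" for n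
  define z where "z n = cis (2 * pi * x n)" for n
  define c where "c n = Complex (1/2) (cot (pi * d n) / 2)" for n
  have s: "\<theta> \<le> sin (pi * d n)" if "n < N" for n
    using that lo[OF that] hi[OF that] \<theta> by (intro sin_pi_ge_margin) (auto simp: d_def)
  have zc: "z n = c n * (z n - z (Suc n))" if "n < N" for n
  proof -
    have "z (Suc n) = z n * cis (2 * (pi * d n))"
      by (simp add: z_def cis_mult d_def algebra_simps)
    then have "c n * (z n - z (Suc n)) = z n * (c n * (1 - cis (2 * (pi * d n))))"
      by (simp add: algebra_simps)
    also have "\<dots> = z n"
      using geometric_coefficient[of "pi * d n"] s[OF that] \<theta> by (simp add: c_def)
    finally show ?thesis by simp
  qed
  have cotb: "\<bar>cot (pi * d n)\<bar> \<le> 1 / \<theta>" if "n < N" for n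
  proof -
    have "\<bar>cot (pi * d n)\<bar> = \<bar>cos (pi * d n)\<bar> / sin (pi * d n)"
      using s[OF that] \<theta> by (simp add: cot_def abs_divide)
    also have "\<dots> \<le> 1 / \<theta>"
      using s[OF that] \<theta> by (intro frac_le) auto
    finally show ?thesis .
  qed
  have cb: "cmod (c n) \<le> 1/2 + 1 / (2 * \<theta>)" if "n < N" for n
    using cmod_le[of "c n"] cotb[OF that] by (simp add: c_def)
  have dc: "cmod (c (Suc n) - c n) = (cot (pi * d n) - cot (pi * d (Suc n))) / 2" if "n < M" for n
  proof -
    have "cot (pi * d (Suc n)) \<le> cot (pi * d n)"
    proof (rule cot_antimono)
      show "0 < pi * d n" using lo[of n] \<theta> that Suc by (simp add: d_def)
      show "pi * d n \<le> pi * d (Suc n)" using mono[of n] that Suc by (simp add: d_def)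
      have "d (Suc n) < 1" using hi[of "Suc n"] \<theta> that Suc by (simp add: d_def)
      then show "pi * d (Suc n) < pi" by simp
    qed
    then show ?thesis
      by (simp add: c_def complex_diff cmod_def complex_eq_iff diff_divide_distrib[symmetric])
  qed
  have "(\<Sum>n<N. z n) = (\<Sum>n<Suc M. c n * (z n - z (Suc n)))"
    using zc Suc by (intro sum.cong) auto
  also have "\<dots> = c 0 * z 0 - c M * z (Suc M) + (\<Sum>n<M. (c (Suc n) - c n) * z (Suc n))"
    by (rule abel_summation)
  finally have "cmod (\<Sum>n<N. z n) \<le> cmod (c 0 * z 0) + cmod (c M * z (Suc M))
     + cmod (\<Sum>n<M. (c (Suc n) - c n) * z (Suc n))"
    using norm_triangle_ineq[of "c 0 * z 0 - c M * z (Suc M)" "\<Sum>n<M. (c (Suc n) - c n) * z (Suc n)"]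
      norm_triangle_ineq4[of "c 0 * z 0" "c M * z (Suc M)"] by simp
  also have "cmod (\<Sum>n<M. (c (Suc n) - c n) * z (Suc n)) \<le> (\<Sum>n<M. cmod ((c (Suc n) - c n) * z (Suc n)))"
    by (rule norm_sum)
  also have "\<dots> = (\<Sum>n<M. cot (pi * d n) / 2 - cot (pi * d (Suc n)) / 2)"
    using dc by (intro sum.cong) (auto simp: norm_mult z_def diff_divide_distrib)
  also have "\<dots> = cot (pi * d 0) / 2 - cot (pi * d M) / 2"
    by (rule sum_lessThan_telescope')
  also have "\<dots> \<le> 1 / \<theta>"
    using cotb[of 0] cotb[of M] Suc by linarith
  also have "cmod (c 0 * z 0) + cmod (c M * z (Suc M)) = cmod (c 0) + cmod (c M)"
    by (simp add: norm_mult z_def)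
  also have "\<dots> \<le> 1/2 + 1 / (2 * \<theta>) + (1/2 + 1 / (2 * \<theta>))"
    using cb[of 0] cb[of M] Suc by linarith
  finally have "cmod (\<Sum>n<N. z n) \<le> 1 + 2 / \<theta>" by (simp add: field_simps)
  also have "\<dots> \<le> 3 / \<theta>" using \<theta> by (simp add: field_simps)
  finally show ?thesis by (simp add: z_def)
qed

lemma monotone_level_set:
  fixes d :: "nat \<Rightarrow> real"
  assumes mono: "\<And>m n. m \<le> n \<Longrightarrow> n < M \<Longrightarrow> d m \<le> d n"
  obtains a b where "{n. n < M \<and> lo \<le> d n \<and> d n \<le> hi} = {a..<b}" "b \<le> M" "a \<le> b"
proof -
  let ?S = "{n. n < M \<and> lo \<le> d n \<and> d n \<le> hi}"
  have fin: "finite ?S" by simp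
  show ?thesis
  proof (cases "?S = {}")
    case True then show ?thesis using that[of 0 0] by simp
  next
    case False
    have m: "Min ?S \<in> ?S" "Max ?S \<in> ?S" using Min_in[OF fin False] Max_in[OF fin False] by auto
    have "?S = {Min ?S..<Suc (Max ?S)}"
    proof
      show "?S \<subseteq> {Min ?S..<Suc (Max ?S)}" using fin by (auto simp: less_Suc_eq_le)
      show "{Min ?S..<Suc (Max ?S)} \<subseteq> ?S"
      proof
        fix n assume n: "n \<in> {Min ?S..<Suc (Max ?S)}"
        have "lo \<le> d (Min ?S)" "d (Max ?S) \<le> hi" "Max ?S < M" using m by auto
        moreover have "d (Min ?S) \<le> d n" "d n \<le> d (Max ?S)"
          using n \<open>Max ?S < M\<close> by (auto intro!: mono)
        ultimately show "n \<in> ?S" using n by auto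
      qed
    qed
    moreover have "Suc (Max ?S) \<le> M" using m by auto
    moreover have "Min ?S \<le> Suc (Max ?S)" using m fin by (meson Max_ge le_SucI)
    ultimately show ?thesis by (rule that)
  qed
qed

text \<open>Subtracting the sequence \<open>k n\<close> leaves the exponentials unchanged and shifts all differences by \<open>k\<close>, so
that \<open>kusmin_landau_unit\<close> applies between any two consecutive integers.\<close>

lemma kusmin_landau_level_set:
  fixes x :: "nat \<Rightarrow> real" and k :: int and \<theta> :: real
  assumes \<theta>: "0 < \<theta>" "\<theta> \<le> 1/2"
    and mono: "\<And>m n. m \<le> n \<Longrightarrow> n < M \<Longrightarrow> x (Suc m) - x m \<le> x (Suc n) - x n"
  shows "cmod (\<Sum>n | n < M \<and> k + \<theta> \<le> x (Suc n) - x n \<and> x (Suc n) - x n \<le> k + 1 - \<theta>.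
           cis (2 * pi * x n)) \<le> 3 / \<theta>"
proof -
  obtain a b where ab: "{n. n < M \<and> k + \<theta> \<le> x (Suc n) - x n \<and> x (Suc n) - x n \<le> k + 1 - \<theta>} = {a..<b}"
    "b \<le> M" "a \<le> b"
    using monotone_level_set[of M "\<lambda>n. x (Suc n) - x n" "k + \<theta>" "k + 1 - \<theta>"] mono by blast
  define y where "y n = x (a + n) - k * real n" for n
  have eq: "cis (2 * pi * x (a + n)) = cis (2 * pi * y n)" for n
  proof -
    have "cis (2 * pi * x (a + n)) = cis (2 * pi * y n) * cis (2 * pi * (k * real n))"
      by (simp add: cis_mult y_def algebra_simps)
    then show ?thesis by simp
  qed
  have in_ab: "k + \<theta> \<le> x (Suc n) - x n \<and> x (Suc n) - x n \<le> k + 1 - \<theta>" if "n \<in> {a..<b}" for n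
    using that unfolding ab(1)[symmetric] by blast
  have "(\<Sum>n\<in>{a..<b}. cis (2 * pi * x n)) = (\<Sum>n<b - a. cis (2 * pi * x (a + n)))"
    using ab(3) by (intro sum.reindex_bij_witness[of _ "\<lambda>n. a + n" "\<lambda>n. n - a"]) auto
  also have "\<dots> = (\<Sum>n<b - a. cis (2 * pi * y n))" by (simp add: eq)
  also have "cmod \<dots> \<le> 3 / \<theta>"
  proof (rule kusmin_landau_unit[OF \<theta>])
    fix n assume n: "n < b - a"
    have "\<theta> \<le> y (Suc n) - y n \<and> y (Suc n) - y n \<le> 1 - \<theta>"
      using in_ab[of "a + n"] n by (auto simp: y_def algebra_simps)
    then show "\<theta> \<le> y (Suc n) - y n" "y (Suc n) - y n \<le> 1 - \<theta>" by auto
  next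
    fix n assume n: "Suc n < b - a"
    show "y (Suc n) - y n \<le> y (Suc (Suc n)) - y (Suc n)"
      using mono[of "a + n" "Suc (a + n)"] n ab by (auto simp: y_def algebra_simps)
  qed
  finally show ?thesis unfolding ab(1) .
qed

lemma card_spaced_values:
  fixes d :: "nat \<Rightarrow> real"
  assumes "0 < \<mu>" "0 \<le> \<Delta>"
    and gap: "\<And>m n. m \<le> n \<Longrightarrow> n < M \<Longrightarrow> \<mu> * real (n - m) \<le> d n - d m"
  shows "card {n. n < M \<and> lo \<le> d n \<and> d n \<le> lo + \<Delta>} \<le> \<Delta> / \<mu> + 1"
proof -
  have mono: "d m \<le> d n" if "m \<le> n" "n < M" for m n
  proof -
    have "0 \<le> \<mu> * real (n - m)" using assms by simp
    then show ?thesis using gap[OF that] by linarith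
  qed
  obtain a b where ab: "{n. n < M \<and> lo \<le> d n \<and> d n \<le> lo + \<Delta>} = {a..<b}" "b \<le> M" "a \<le> b"
    using monotone_level_set[of M d lo "lo + \<Delta>"] mono by blast
  show ?thesis
  proof (cases "a = b")
    case True then show ?thesis using assms by (simp add: ab(1))
  next
    case False
    then have "a \<in> {a..<b}" "b - 1 \<in> {a..<b}" using ab by auto
    then have "d (b - 1) - d a \<le> \<Delta>" unfolding ab(1)[symmetric] by auto
    moreover have "a \<le> b - 1" "b - 1 < M" using False ab(2,3) by linarith+
    ultimately have "\<mu> * real (b - 1 - a) \<le> \<Delta>" using gap[of a "b - 1"] by linarith
    then have "real (b - 1 - a) \<le> \<Delta> / \<mu>" using assms by (simp add: field_simps)
    then show ?thesis using False ab(2,3) unfolding ab(1) by (simp add: of_nat_diff)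
  qed
qed

text \<open>Van der Corput's second derivative test in terms of differences. The terms are grouped by the integer part of
the difference. In each group, the differences that lie within \<open>sqrt \<mu> / 2\<close> of an integer are few, because
they are \<open>\<mu>\<close>-spaced; the others are covered by the Kusmin-Landau inequality. The threshold \<open>sqrt \<mu> / 2\<close> balances
the two contributions.\<close>

lemma second_difference_test_small:
  fixes x :: "nat \<Rightarrow> real"
  assumes \<mu>: "0 < \<mu>" "\<mu> \<le> 1" and T_nonneg: "0 \<le> T"
    and gap: "\<And>m n. m \<le> n \<Longrightarrow> n < M \<Longrightarrow>
          \<mu> * real (n - m) \<le> (x (Suc n) - x n) - (x (Suc m) - x m)"
    and T: "\<And>n. n < M \<Longrightarrow> x (Suc n) - x n \<le> x (Suc 0) - x 0 + T"
  shows "cmod (\<Sum>n<M. cis (2 * pi * x n)) \<le> 18 * (T + 1) / sqrt \<mu>"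
proof (cases "M = 0")
  case True then show ?thesis using assms by simp
next
  case False
  define d where "d n = x (Suc n) - x n" for n
  have gap': "\<mu> * real (n - m) \<le> d n - d m" if "m \<le> n" "n < M" for m n
    using gap[OF that] by (simp add: d_def)
  have mono: "d m \<le> d n" if "m \<le> n" "n < M" for m n
  proof -
    have "0 \<le> \<mu> * real (n - m)" using \<mu> by simp
    then show ?thesis using gap'[OF that] by linarith
  qed
  \<comment> \<open>The distance to an integer below which a difference counts as exceptional.\<close>
  define \<Delta> where "\<Delta> = sqrt \<mu> / 2"
  have \<Delta>: "0 < \<Delta>" "\<Delta> \<le> 1/2" using \<mu> by (auto simp: \<Delta>_def)
  have sq: "sqrt \<mu> * sqrt \<mu> = \<mu>" "0 < sqrt \<mu>" "sqrt \<mu> \<le> 1" using \<mu> by auto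
  define K where "K = {\<lfloor>d 0\<rfloor>..\<lfloor>d 0 + T\<rfloor>}"
  define z where "z n = cis (2 * pi * x n)" for n
  have block: "cmod (\<Sum>n | n < M \<and> \<lfloor>d n\<rfloor> = k. z n) \<le> 9 / sqrt \<mu>" for k :: int
  proof -
    \<comment> \<open>\<open>?A\<close> and \<open>?C\<close> collect the exceptional differences, near \<open>k\<close> and near \<open>k + 1\<close>.\<close>
    let ?A = "{n. n < M \<and> \<lfloor>d n\<rfloor> = k \<and> d n < k + \<Delta>}"
    let ?B = "{n. n < M \<and> k + \<Delta> \<le> d n \<and> d n \<le> k + 1 - \<Delta>}"
    let ?C = "{n. n < M \<and> \<lfloor>d n\<rfloor> = k \<and> k + 1 - \<Delta> < d n}"
    have un: "{n. n < M \<and> \<lfloor>d n\<rfloor> = k} = ?A \<union> (?B \<union> ?C)"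
      using \<Delta> by (auto simp: floor_eq_iff)
    have "(\<Sum>n | n < M \<and> \<lfloor>d n\<rfloor> = k. z n) = sum z ?A + (sum z ?B + sum z ?C)"
    proof -
      have "?B \<inter> ?C = {}" "?A \<inter> (?B \<union> ?C) = {}" using \<Delta> by auto
      then show ?thesis unfolding un by (simp add: sum.union_disjoint)
    qed
    then have tri: "cmod (\<Sum>n | n < M \<and> \<lfloor>d n\<rfloor> = k. z n) \<le> cmod (sum z ?A) + (cmod (sum z ?B) + cmod (sum z ?C))"
      using norm_triangle_ineq[of "sum z ?A" "sum z ?B + sum z ?C"] norm_triangle_ineq[of "sum z ?B" "sum z ?C"]
      by simp
    have "cmod (sum z ?A) \<le> card ?A"
      using norm_sum[of z ?A] by (simp add: z_def)
    moreover have "card ?A \<le> card {n. n < M \<and> real_of_int k \<le> d n \<and> d n \<le> k + \<Delta>}"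
      by (intro card_mono) (auto simp: floor_eq_iff)
    moreover have "card {n. n < M \<and> real_of_int k \<le> d n \<and> d n \<le> k + \<Delta>} \<le> \<Delta> / \<mu> + 1"
      using card_spaced_values[of \<mu> \<Delta> M d k] gap' \<mu> \<Delta> by auto
    ultimately have A: "cmod (sum z ?A) \<le> \<Delta> / \<mu> + 1" by linarith
    have "cmod (sum z ?C) \<le> card ?C"
      using norm_sum[of z ?C] by (simp add: z_def)
    moreover have "card ?C \<le> card {n. n < M \<and> k + 1 - \<Delta> \<le> d n \<and> d n \<le> k + 1 - \<Delta> + \<Delta>}"
      by (intro card_mono) (auto simp: floor_eq_iff)
    moreover have "card {n. n < M \<and> k + 1 - \<Delta> \<le> d n \<and> d n \<le> k + 1 - \<Delta> + \<Delta>} \<le> \<Delta> / \<mu> + 1"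
      using card_spaced_values[of \<mu> \<Delta> M d "k + 1 - \<Delta>"] gap' \<mu> \<Delta> by auto
    ultimately have C: "cmod (sum z ?C) \<le> \<Delta> / \<mu> + 1" by linarith
    have B: "cmod (sum z ?B) \<le> 3 / \<Delta>"
      using kusmin_landau_level_set[of \<Delta> M x k] \<Delta> mono by (simp add: d_def z_def)
    have "\<Delta> / \<mu> + 1 + (3 / \<Delta> + (\<Delta> / \<mu> + 1)) = 7 / sqrt \<mu> + 2"
      using \<mu> sq by (simp add: \<Delta>_def field_simps)
    also have "\<dots> \<le> 9 / sqrt \<mu>" using sq by (simp add: field_simps)
    finally show ?thesis using tri A B C by linarith
  qed
  have K: "(\<lambda>n. \<lfloor>d n\<rfloor>) ` {..<M} \<subseteq> K"
    using mono[of 0] T by (auto simp: K_def d_def intro!: floor_mono)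
  have "(\<Sum>n<M. z n) = (\<Sum>k\<in>K. \<Sum>n | n \<in> {..<M} \<and> \<lfloor>d n\<rfloor> = k. z n)"
    using K by (intro sum.group[symmetric]) (auto simp: K_def)
  also have "cmod \<dots> \<le> (\<Sum>k\<in>K. cmod (\<Sum>n | n < M \<and> \<lfloor>d n\<rfloor> = k. z n))"
    using norm_sum by auto
  also have "\<dots> \<le> (\<Sum>k\<in>K. 9 / sqrt \<mu>)" by (intro sum_mono block)
  also have "\<dots> = real (card K) * (9 / sqrt \<mu>)" by simp
  also have "\<dots> \<le> (2 * (T + 1)) * (9 / sqrt \<mu>)"
  proof (rule mult_right_mono)
    have "\<lfloor>d 0 + T\<rfloor> + 1 - \<lfloor>d 0\<rfloor> \<ge> 0" using \<open>0 \<le> T\<close> floor_mono[of "d 0" "d 0 + T"] by linarith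
    then have "real (card K) = \<lfloor>d 0 + T\<rfloor> + 1 - \<lfloor>d 0\<rfloor>" by (simp add: K_def)
    also have "\<dots> \<le> T + 2" by linarith
    finally show "real (card K) \<le> 2 * (T + 1)" using \<open>0 \<le> T\<close> by argo
  qed (use \<mu> in auto)
  finally show ?thesis by (simp add: z_def)
qed

text \<open>For \<open>\<mu> > 1\<close> the spacing of the differences leaves room for so few terms that the trivial bound suffices.\<close>

lemma second_difference_test:
  fixes x :: "nat \<Rightarrow> real"
  assumes \<mu>: "0 < \<mu>" and T_nonneg: "0 \<le> T"
    and gap: "\<And>m n. m \<le> n \<Longrightarrow> n < M \<Longrightarrow>
          \<mu> * real (n - m) \<le> (x (Suc n) - x n) - (x (Suc m) - x m)"
    and T: "\<And>n. n < M \<Longrightarrow> x (Suc n) - x n \<le> x (Suc 0) - x 0 + T"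
  shows "cmod (\<Sum>n<M. cis (2 * pi * x n)) \<le> 18 * (T + 1) / sqrt \<mu> + 1"
proof (cases "\<mu> \<le> 1")
  case True
  from second_difference_test_small[OF \<mu> True assms(2) gap T]
  show ?thesis by fastforce
next
  case False
  have "cmod (\<Sum>n<M. cis (2 * pi * x n)) \<le> M"
    using norm_sum[of "\<lambda>n. cis (2 * pi * x n)" "{..<M}"] by simp
  also have "M \<le> T / \<mu> + 1"
  proof (cases "M = 0")
    case True then show ?thesis using assms by simp
  next
    case M: False
    have "\<mu> * real (M - 1) \<le> T" using gap[of 0 "M - 1"] T[of "M - 1"] M by auto
    then show ?thesis using \<mu> M by (simp add: field_simps of_nat_diff)
  qed
  also have "T / \<mu> \<le> 18 * (T + 1) / sqrt \<mu>"
  proof (rule frac_le)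
    show "sqrt \<mu> \<le> \<mu>" using False
      by (smt (verit) real_sqrt_ge_one real_sqrt_mult_self mult_le_cancel_left1)
  qed (use assms in auto)
  finally show ?thesis by simp
qed

section \<open>The Fourier series of the second Bernoulli polynomial\<close>

definition cosine_series :: "real \<Rightarrow> real" where
  "cosine_series x = (\<Sum>h. cos (2 * pi * real (Suc h) * x) / (real (Suc h))\<^sup>2)"

definition damped_cosine_series :: "real \<Rightarrow> real \<Rightarrow> real" where
  "damped_cosine_series \<rho> x = (\<Sum>h. \<rho> ^ Suc h * cos (2 * pi * real (Suc h) * x) / (real (Suc h))\<^sup>2)"

lemma summable_inverse_squares_Suc: "summable (\<lambda>h. 1 / (real (Suc h))\<^sup>2)"
  using inverse_squares_sums by (simp add: sums_iff add.commute)

lemma cosine_series_summable: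
  "summable (\<lambda>h. cos (2 * pi * real (Suc h) * x) / (real (Suc h))\<^sup>2)"
  by (rule summable_comparison_test'[OF summable_inverse_squares_Suc, of 0])
     (auto simp: divide_right_mono)

lemma Im_Ln_one_minus_cis:
  assumes "0 < t" "t < 1"
  shows "Im (Ln (1 - cis (2 * pi * t))) = pi * (t - 1/2)"
proof -
  have s: "sin (pi * t) > 0" using assms by (intro sin_gt_zero) auto
  have "1 - cis (2 * pi * t) = exp (Complex (ln (2 * sin (pi * t))) (pi * t - pi/2))"
  proof -
    have "exp (Complex (ln (2 * sin (pi * t))) (pi * t - pi/2)) = of_real (2 * sin (pi * t)) * cis (pi * t - pi/2)"
      using s by (simp add: exp_eq_polar)
    moreover have "1 - cos (2 * (pi * t)) = 2 * sin (pi * t) * sin (pi * t)"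
      by (simp add: cos_double_sin power2_eq_square)
    moreover have "sin (2 * (pi * t)) = 2 * sin (pi * t) * cos (pi * t)" by (simp add: sin_double)
    ultimately show ?thesis
      by (simp add: complex_eq_iff cos_diff sin_diff mult.assoc)
  qed
  moreover have "- pi < pi * t - pi/2" "pi * t - pi/2 \<le> pi"
    using mult_pos_pos[OF pi_gt_zero assms(1)] mult_strict_left_mono[OF assms(2) pi_gt_zero] pi_gt_zero
    by linarith+
  ultimately have "Ln (1 - cis (2 * pi * t)) = Complex (ln (2 * sin (pi * t))) (pi * t - pi/2)"
    by (intro Ln_unique) auto
  then show ?thesis by (simp add: algebra_simps)
qed

lemma damped_sine_series:
  assumes "0 \<le> \<rho>" "\<rho> < 1"
  shows "(\<lambda>h. \<rho> ^ Suc h * sin (2 * pi * real (Suc h) * x) / real (Suc h)) sums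
          - Im (Ln (1 - of_real \<rho> * cis (2 * pi * x)))"
proof -
  define w where "w = of_real \<rho> * cis (2 * pi * x)"
  have "cmod (- w) < 1" using assms by (simp add: w_def norm_mult)
  from Ln_series'[OF this] have "(\<lambda>n. - (w ^ n) / of_nat n) sums Ln (1 - w)" by simp
  then have "(\<lambda>n. - (w ^ Suc n) / of_nat (Suc n)) sums Ln (1 - w)"
    by (subst sums_Suc_iff) simp
  from sums_minus[OF sums_Im[OF this]]
  have "(\<lambda>n. - Im (- (w ^ Suc n) / of_nat (Suc n))) sums - Im (Ln (1 - w))" .
  moreover have "- Im (- (w ^ Suc n) / of_nat (Suc n)) =
      \<rho> ^ Suc n * sin (2 * pi * real (Suc n) * x) / real (Suc n)" for n
  proof -
    have "w ^ Suc n = of_real (\<rho> ^ Suc n) * cis (real (Suc n) * (2 * pi * x))"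
      unfolding w_def power_mult_distrib Complex.DeMoivre by simp
    then have "Im (w ^ Suc n) = \<rho> ^ Suc n * sin (real (Suc n) * (2 * pi * x))" by simp
    moreover have "- Im (- (w ^ Suc n) / of_nat (Suc n)) = Im (w ^ Suc n) / real (Suc n)"
      by (metis Im_divide_of_nat minus_divide_left uminus_complex.sel(2) minus_minus)
    ultimately show ?thesis by (simp add: mult_ac)
  qed
  ultimately show ?thesis unfolding w_def by simp
qed

text \<open>The damping factor makes differentiation term by term legitimate. The derivative is a sine series, which is the imaginary part of a
complex logarithm.\<close>

lemma damped_cosine_series_deriv:
  assumes "0 \<le> \<rho>" "\<rho> < 1"
  shows "(damped_cosine_series \<rho> has_real_derivative
          2 * pi * Im (Ln (1 - of_real \<rho> * cis (2 * pi * x)))) (at x)"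
proof -
  let ?f = "\<lambda>h x. \<rho> ^ Suc h * cos (2 * pi * real (Suc h) * x) / (real (Suc h))\<^sup>2"
  let ?f' = "\<lambda>h x. - (2 * pi) * (\<rho> ^ Suc h * sin (2 * pi * real (Suc h) * x) / real (Suc h))"
  have "((\<lambda>x. \<Sum>h. ?f h x) has_real_derivative (\<Sum>h. ?f' h x)) (at x)"
  proof (rule has_field_derivative_series'(2)[of UNIV ?f ?f' 0 x])
    show "(?f h has_real_derivative ?f' h y) (at y within UNIV)" for h y
      by (auto intro!: derivative_eq_intros simp: power2_eq_square field_simps simp del: of_nat_Suc power_Suc)
    show "uniformly_convergent_on UNIV (\<lambda>n x. \<Sum>i<n. ?f' i x)"
    proof (rule Weierstrass_m_test')
      show "summable (\<lambda>h. 2 * pi * \<rho> ^ h)" using assms by (intro summable_mult summable_geometric) auto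
      fix h y
      have "\<rho> ^ Suc h * \<bar>sin (2 * pi * real (Suc h) * y)\<bar> / real (Suc h) \<le> \<rho> ^ h * 1 / 1"
        using assms by (intro frac_le mult_mono power_decreasing) auto
      from mult_left_mono[OF this, of "2 * pi"]
      show "norm (?f' h y) \<le> 2 * pi * \<rho> ^ h"
        using assms by (simp add: abs_mult del: of_nat_Suc power_Suc)
    qed
    show "summable (\<lambda>n. ?f n 0)"
    proof (rule summable_comparison_test'[OF summable_inverse_squares_Suc, of 0])
      fix h
      show "norm (?f h 0) \<le> 1 / (real (Suc h))\<^sup>2"
        using assms by (auto intro!: divide_right_mono power_le_one simp del: of_nat_Suc power_Suc)
    qed
  qed auto
  moreover have "(\<Sum>h. ?f' h x) = 2 * pi * Im (Ln (1 - of_real \<rho> * cis (2 * pi * x)))"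
    using sums_mult[OF damped_sine_series[OF assms, of x], of "- (2 * pi)"] by (simp add: sums_iff)
  ultimately show ?thesis by (simp add: damped_cosine_series_def[abs_def])
qed

lemma damped_cosine_series_tendsto:
  "(\<lambda>n. damped_cosine_series (real n / real (Suc n)) x) \<longlonglongrightarrow> cosine_series x"
proof -
  let ?M = "\<lambda>h. 1 / (real (Suc h))\<^sup>2"
  have lim: "(\<lambda>n. (real n / real (Suc n)) ^ Suc h * cos (2 * pi * real (Suc h) * x) / (real (Suc h))\<^sup>2)
     \<longlonglongrightarrow> cos (2 * pi * real (Suc h) * x) / (real (Suc h))\<^sup>2" for h
  proof -
    have "(\<lambda>n. (real n / real (Suc n)) ^ Suc h * cos (2 * pi * real (Suc h) * x) / (real (Suc h))\<^sup>2)
     \<longlonglongrightarrow> 1 ^ Suc h * cos (2 * pi * real (Suc h) * x) / (real (Suc h))\<^sup>2"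
      by (intro tendsto_intros LIMSEQ_n_over_Suc_n) auto
    then show ?thesis by simp
  qed
  have bd: "norm ((real n / real (Suc n)) ^ Suc h * cos (2 * pi * real (Suc h) * x) / (real (Suc h))\<^sup>2)
     \<le> ?M h" for n h
  proof -
    have "(real n / real (Suc n)) ^ Suc h * \<bar>cos (2 * pi * real (Suc h) * x)\<bar> \<le> 1 * 1"
      by (intro mult_mono power_le_one) auto
    then show ?thesis
      by (auto simp: abs_mult power_abs intro!: divide_right_mono simp del: of_nat_Suc power_Suc)
  qed
  have "eventually (\<lambda>(h, n). norm ((real n / real (Suc n)) ^ Suc h * cos (2 * pi * real (Suc h) * x) / (real (Suc h))\<^sup>2)
     \<le> ?M h) (at_top \<times>\<^sub>F sequentially)"
    using bd by (intro always_eventually) auto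
  from tannerys_theorem[OF lim this summable_inverse_squares_Suc]
  show ?thesis
    unfolding damped_cosine_series_def cosine_series_def by simp
qed

text \<open>The damping is removed under the integral sign: the imaginary part of the logarithm never exceeds \<open>pi\<close>, and in the limit
it is the linear function of \<open>Im_Ln_one_minus_cis\<close>.\<close>

lemma cosine_series_diff:
  assumes "0 < a" "a \<le> b" "b < 1"
  shows "cosine_series b - cosine_series a = pi\<^sup>2 * (b\<^sup>2 - b) - pi\<^sup>2 * (a\<^sup>2 - a)"
proof -
  let ?r = "\<lambda>n. real n / real (Suc n)"
  let ?g = "\<lambda>n t. 2 * pi * Im (Ln (1 - of_real (?r n) * cis (2 * pi * t)))"
  have int: "(?g n has_integral damped_cosine_series (?r n) b - damped_cosine_series (?r n) a) {a..b}" for n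
  proof (rule fundamental_theorem_of_calculus[OF assms(2)])
    fix t
    have "(damped_cosine_series (?r n) has_real_derivative ?g n t) (at t)"
      by (rule damped_cosine_series_deriv) auto
    then show "(damped_cosine_series (?r n) has_vector_derivative ?g n t) (at t within {a..b})"
      by (simp add: has_real_derivative_iff_has_vector_derivative has_vector_derivative_at_within)
  qed
  have "(\<lambda>n. integral {a..b} (?g n)) \<longlonglongrightarrow> integral {a..b} (\<lambda>t. 2 * pi * (pi * (t - 1/2)))"
  proof (rule dominated_convergence(2)[where h = "\<lambda>_. 2 * pi * pi"])
    show "?g n integrable_on {a..b}" for n using int by blast
    fix n :: nat and t assume t: "t \<in> {a..b}"
    have "1 - of_real (?r n) * cis (2 * pi * t) \<noteq> 0"
    proof
      assume "1 - of_real (?r n) * cis (2 * pi * t) = 0"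
      then have "cmod (of_real (?r n) * cis (2 * pi * t)) = cmod 1" by simp
      then show False by (simp add: norm_mult norm_divide del: of_nat_Suc)
    qed
    then have "\<bar>Im (Ln (1 - of_real (?r n) * cis (2 * pi * t)))\<bar> \<le> pi"
      using mpi_less_Im_Ln Im_Ln_le_pi by (smt (verit))
    then show "norm (?g n t) \<le> 2 * pi * pi" by (simp add: abs_mult)
  next
    fix t assume t: "t \<in> {a..b}"
    have s: "sin (pi * t) > 0" using assms t by (intro sin_gt_zero) auto
    have "Re (1 - cis (2 * pi * t)) = 2 * (sin (pi * t))\<^sup>2"
      using cos_double_sin[of "pi * t"] by (simp add: mult.assoc)
    then have "Re (1 - 1 * cis (2 * pi * t)) > 0" using s by simp
    then have np: "1 - of_real 1 * cis (2 * pi * t) \<notin> \<real>\<^sub>\<le>\<^sub>0"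
      using complex_nonpos_Reals_iff by (metis not_less of_real_1)
    have "(\<lambda>n. ?g n t) \<longlonglongrightarrow> 2 * pi * Im (Ln (1 - of_real 1 * cis (2 * pi * t)))"
      using np by (intro tendsto_intros LIMSEQ_n_over_Suc_n) auto
    then show "(\<lambda>n. ?g n t) \<longlonglongrightarrow> 2 * pi * (pi * (t - 1/2))"
      using Im_Ln_one_minus_cis[of t] assms t by simp
  qed auto
  moreover have "integral {a..b} (?g n) = damped_cosine_series (?r n) b - damped_cosine_series (?r n) a" for n
    using int by (rule integral_unique)
  ultimately have "(\<lambda>n. damped_cosine_series (?r n) b - damped_cosine_series (?r n) a)
      \<longlonglongrightarrow> integral {a..b} (\<lambda>t. 2 * pi * (pi * (t - 1/2)))" by (simp only:)
  moreover have "((\<lambda>t. 2 * pi * (pi * (t - 1/2))) has_integral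
      pi\<^sup>2 * (b\<^sup>2 - b) - pi\<^sup>2 * (a\<^sup>2 - a)) {a..b}"
    using assms
    by (intro fundamental_theorem_of_calculus)
       (auto intro!: derivative_eq_intros
          simp: has_real_derivative_iff_has_vector_derivative[symmetric] power2_eq_square algebra_simps)
  ultimately have "(\<lambda>n. damped_cosine_series (?r n) b - damped_cosine_series (?r n) a)
      \<longlonglongrightarrow> pi\<^sup>2 * (b\<^sup>2 - b) - pi\<^sup>2 * (a\<^sup>2 - a)" by (simp only: integral_unique)
  moreover have "(\<lambda>n. damped_cosine_series (?r n) b - damped_cosine_series (?r n) a)
      \<longlonglongrightarrow> cosine_series b - cosine_series a"
    by (intro tendsto_diff damped_cosine_series_tendsto)
  ultimately show ?thesis using LIMSEQ_unique by blast
qed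

lemma continuous_on_cosine_series: "continuous_on UNIV cosine_series"
proof -
  have "uniform_limit UNIV (\<lambda>n x. \<Sum>h<n. cos (2 * pi * real (Suc h) * x) / (real (Suc h))\<^sup>2)
      (\<lambda>x. \<Sum>h. cos (2 * pi * real (Suc h) * x) / (real (Suc h))\<^sup>2) sequentially"
    by (rule Weierstrass_m_test[OF _ summable_inverse_squares_Suc])
       (auto intro!: divide_right_mono simp del: of_nat_Suc)
  then show ?thesis unfolding cosine_series_def[abs_def]
    by (rule uniform_limit_theorem[rotated])
       (auto intro!: always_eventually continuous_intros simp del: of_nat_Suc)
qed

text \<open>The constant of integration comes from the value at \<open>0\<close>, the Basel sum.\<close>

lemma cosine_series_unit_interval:
  assumes "0 \<le> x" "x < 1"
  shows "cosine_series x = pi\<^sup>2 * (x\<^sup>2 - x + 1/6)"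
proof -
  have S0: "cosine_series 0 = pi\<^sup>2 / 6"
    using inverse_squares_sums by (simp add: cosine_series_def sums_iff add.commute)
  show ?thesis
  proof (cases "x = 0")
    case False
    with assms have x: "0 < x" by simp
    have "continuous (at_right 0) cosine_series"
      using continuous_on_cosine_series by (simp add: continuous_on_eq_continuous_at continuous_at_imp_continuous_at_within)
    then have "(cosine_series \<longlongrightarrow> cosine_series 0) (at_right 0)" by (simp add: continuous_within)
    then have lim: "((\<lambda>a. cosine_series a + pi\<^sup>2 * (x\<^sup>2 - x) - pi\<^sup>2 * (a\<^sup>2 - a)) \<longlongrightarrow>
       cosine_series 0 + pi\<^sup>2 * (x\<^sup>2 - x) - pi\<^sup>2 * (0\<^sup>2 - 0)) (at_right 0)"
      by (intro tendsto_intros)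
    have ev: "eventually (\<lambda>a. cosine_series a + pi\<^sup>2 * (x\<^sup>2 - x) - pi\<^sup>2 * (a\<^sup>2 - a) = cosine_series x) (at_right 0)"
    proof -
      have "eventually (\<lambda>a. a \<in> {0<..<x}) (at_right (0::real))"
        by (rule eventually_at_right_real[OF x])
      then show ?thesis
      proof eventually_elim
        case (elim a)
        then show ?case using cosine_series_diff[of a x] assms by (simp add: algebra_simps)
      qed
    qed
    have "cosine_series x = cosine_series 0 + pi\<^sup>2 * (x\<^sup>2 - x) - pi\<^sup>2 * (0\<^sup>2 - 0)"
      using tendsto_unique[OF _ tendsto_eventually[OF ev] lim] by simp
    then show ?thesis unfolding S0 by (simp add: distrib_left right_diff_distrib)
  next
    case True
    show ?thesis unfolding True S0 by simp
  qed
qed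

text \<open>The periodic extension of the second Bernoulli polynomial, whose half is a primitive of \<open>sawtooth\<close> below.\<close>

definition bernoulli2 :: "real \<Rightarrow> real" where
  "bernoulli2 x = (frac x)\<^sup>2 - frac x + 1/6"

lemma bernoulli2_fourier:
  "(\<lambda>h. cos (2 * pi * real (Suc h) * x) / (real (Suc h))\<^sup>2) sums (pi\<^sup>2 * bernoulli2 x)"
proof -
  have "cos (2 * pi * real (Suc h) * x) = cos (2 * pi * real (Suc h) * frac x)" for h
  proof -
    have "cos (2 * pi * real (Suc h) * x) =
        cos (2 * pi * real (Suc h) * frac x + 2 * pi * of_int (int (Suc h) * \<lfloor>x\<rfloor>))"
      by (simp add: frac_def algebra_simps)
    then show ?thesis by (simp only: cos_add cos_int_2pin sin_int_2pin)
  qed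
  then have "cosine_series x = cosine_series (frac x)" by (simp add: cosine_series_def)
  also have "\<dots> = pi\<^sup>2 * bernoulli2 x"
    unfolding bernoulli2_def by (intro cosine_series_unit_interval) (auto simp: frac_lt_1)
  finally show ?thesis
    using cosine_series_summable[of x] by (simp add: cosine_series_def sums_iff)
qed

section \<open>Sawtooth sums along concave sequences\<close>

definition sawtooth :: "real \<Rightarrow> real" where
  "sawtooth x = frac x - 1/2"

lemma abs_sawtooth_le: "\<bar>sawtooth x\<bar> \<le> 1/2"
  using frac_lt_1[of x] frac_ge_0[of x] unfolding sawtooth_def by linarith

text \<open>The sawtooth has slope one and all its jumps are downwards, so that \<open>sawtooth (x + t) \<le> sawtooth x + t\<close>
for \<open>t \<ge> 0\<close>. Averaging over \<open>t\<close> between \<open>0\<close> and \<open>\<delta>\<close> yields this bound, and averaging to the left of \<open>x\<close> the next one.\<close>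

lemma sawtooth_lower:
  assumes "0 < \<delta>" "\<delta> \<le> 1"
  shows "(bernoulli2 (x + \<delta>) - bernoulli2 x) / (2 * \<delta>) - \<delta> / 2 \<le> sawtooth x"
proof -
  define u where "u = frac x"
  have u: "0 \<le> u" "u < 1" by (auto simp: u_def frac_lt_1)
  have "bernoulli2 (x + \<delta>) \<le> (u + \<delta>)\<^sup>2 - (u + \<delta>) + 1/6"
  proof (cases "u + \<delta> < 1")
    case True
    then have "frac (x + \<delta>) = u + \<delta>"
      unfolding frac_unique_iff using u assms by (auto simp: u_def frac_def)
    then show ?thesis by (simp add: bernoulli2_def)
  next
    case False
    have "x + \<delta> - (u + \<delta> - 1) = of_int (\<lfloor>x\<rfloor> + 1)" by (simp add: u_def frac_def)
    then have "x + \<delta> - (u + \<delta> - 1) \<in> \<int>" by (metis Ints_of_int)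
    then have fr: "frac (x + \<delta>) = u + \<delta> - 1"
      unfolding frac_unique_iff using u assms False by auto
    have "bernoulli2 (x + \<delta>) = (u + \<delta>)\<^sup>2 - (u + \<delta>) + 1/6 - 2 * (u + \<delta> - 1)"
      unfolding bernoulli2_def fr by (simp add: power2_eq_square algebra_simps)
    then show ?thesis using False by simp
  qed
  moreover have "(u + \<delta>)\<^sup>2 - (u + \<delta>) + 1/6 - bernoulli2 x = 2 * \<delta> * (sawtooth x + \<delta> / 2)"
    by (simp add: bernoulli2_def sawtooth_def u_def power2_eq_square algebra_simps)
  ultimately have "bernoulli2 (x + \<delta>) - bernoulli2 x \<le> 2 * \<delta> * (sawtooth x + \<delta> / 2)" by linarith
  then have "(bernoulli2 (x + \<delta>) - bernoulli2 x) / (2 * \<delta>) \<le> sawtooth x + \<delta> / 2"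
    using assms by (simp add: pos_divide_le_eq mult.commute)
  then show ?thesis by simp
qed

lemma sawtooth_upper:
  assumes "0 < \<delta>" "\<delta> \<le> 1"
  shows "sawtooth x \<le> (bernoulli2 x - bernoulli2 (x - \<delta>)) / (2 * \<delta>) + \<delta> / 2"
proof -
  define u where "u = frac x"
  have u: "0 \<le> u" "u < 1" by (auto simp: u_def frac_lt_1)
  have "bernoulli2 (x - \<delta>) \<le> (u - \<delta>)\<^sup>2 - (u - \<delta>) + 1/6"
  proof (cases "0 \<le> u - \<delta>")
    case True
    then have "frac (x - \<delta>) = u - \<delta>"
      unfolding frac_unique_iff using u assms by (auto simp: u_def frac_def)
    then show ?thesis by (simp add: bernoulli2_def)
  next
    case False
    have "x - \<delta> - (u - \<delta> + 1) = of_int (\<lfloor>x\<rfloor> - 1)" by (simp add: u_def frac_def)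
    then have "x - \<delta> - (u - \<delta> + 1) \<in> \<int>" by (metis Ints_of_int)
    then have fr: "frac (x - \<delta>) = u - \<delta> + 1"
      unfolding frac_unique_iff using u assms False by auto
    have "bernoulli2 (x - \<delta>) = (u - \<delta>)\<^sup>2 - (u - \<delta>) + 1/6 + 2 * (u - \<delta>)"
      unfolding bernoulli2_def fr by (simp add: power2_eq_square algebra_simps)
    then show ?thesis using False by simp
  qed
  moreover have "bernoulli2 x - ((u - \<delta>)\<^sup>2 - (u - \<delta>) + 1/6) = 2 * \<delta> * (sawtooth x - \<delta> / 2)"
    by (simp add: bernoulli2_def sawtooth_def u_def power2_eq_square algebra_simps)
  ultimately have "2 * \<delta> * (sawtooth x - \<delta> / 2) \<le> bernoulli2 x - bernoulli2 (x - \<delta>)" by linarith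
  then have "sawtooth x - \<delta> / 2 \<le> (bernoulli2 x - bernoulli2 (x - \<delta>)) / (2 * \<delta>)"
    using assms by (simp add: pos_le_divide_eq mult.commute)
  then show ?thesis by simp
qed

lemma norm_cis_minus_one_le: "cmod (cis t - 1) \<le> \<bar>t\<bar>"
proof -
  have "cmod (cis t - 1) = 2 * \<bar>sin (t / 2)\<bar>"
    using dist_exp_i_1[of t] by (simp add: cis_conv_exp)
  also have "\<bar>sin (t / 2)\<bar> \<le> \<bar>t / 2\<bar>" by (rule abs_sin_x_le_abs_x)
  finally show ?thesis by simp
qed

text \<open>Up to a constant factor, this bounds the \<open>m\<close>-th Fourier coefficient of the sawtooth averaged over an interval of length
\<open>1 / H\<close>. Its decay like \<open>1 / m\<^sup>2\<close> beyond \<open>H\<close> makes the series converge absolutely.\<close>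

definition fourier_weight :: "nat \<Rightarrow> nat \<Rightarrow> real" where
  "fourier_weight H m = min (1 / real m) (real H / (real m)\<^sup>2)"

text \<open>In the Fourier series of the increments, the factor \<open>cis (2 * pi * h * d) - 1\<close> is at most \<open>2 * pi * h * \<bar>d\<bar>\<close> and
at most \<open>2\<close>, which accounts for the two branches of \<open>fourier_weight\<close>. The bound is proved for partial sums and passed to the limit.\<close>

lemma bernoulli2_increment_sum:
  fixes x :: "'b \<Rightarrow> real"
  assumes H: "H \<ge> 1" and d: "\<bar>d\<bar> = 1 / real H"
    and E: "\<And>h. h \<ge> 1 \<Longrightarrow> cmod (\<Sum>i\<in>I. cis (2 * pi * (real h * x i))) \<le> E h"
    and W: "\<And>n. (\<Sum>h<n. fourier_weight H (Suc h) * E (Suc h)) \<le> W"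
  shows "\<bar>\<Sum>i\<in>I. bernoulli2 (x i + d) - bernoulli2 (x i)\<bar> \<le> 2 * W / real H"
proof -
  let ?D = "\<Sum>i\<in>I. bernoulli2 (x i + d) - bernoulli2 (x i)"
  let ?t = "\<lambda>h. \<Sum>i\<in>I. cos (2 * pi * real (Suc h) * (x i + d)) / (real (Suc h))\<^sup>2
                   - cos (2 * pi * real (Suc h) * x i) / (real (Suc h))\<^sup>2"
  have Hp: "real H > 0" using H by simp
  have "?t sums (\<Sum>i\<in>I. pi\<^sup>2 * bernoulli2 (x i + d) - pi\<^sup>2 * bernoulli2 (x i))"
    by (intro sums_sum sums_diff bernoulli2_fourier)
  then have "?t sums (pi\<^sup>2 * ?D)" by (simp add: sum_distrib_left right_diff_distrib)
  then have lim: "(\<lambda>n. \<bar>\<Sum>h<n. ?t h\<bar>) \<longlonglongrightarrow> \<bar>pi\<^sup>2 * ?D\<bar>"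
    unfolding sums_def by (rule tendsto_rabs)
  have term_le: "\<bar>?t h\<bar> \<le> 2 * pi / real H * (fourier_weight H (Suc h) * E (Suc h))" for h
  proof -
    define m where "m = real (Suc h)"
    have m: "m \<ge> 1" by (simp add: m_def)
    define S where "S = (\<Sum>i\<in>I. cis (2 * pi * (m * x i)))"
    have SE: "cmod S \<le> E (Suc h)" using E[of "Suc h"] by (simp add: S_def m_def)
    then have E0: "E (Suc h) \<ge> 0" by (rule order_trans[OF norm_ge_zero])
    have "(cis (2 * pi * m * d) - 1) * S =
        (\<Sum>i\<in>I. cis (2 * pi * m * (x i + d)) - cis (2 * pi * m * x i))"
      by (simp add: S_def sum_distrib_left left_diff_distrib cis_mult algebra_simps)
    then have "?t h = Re ((cis (2 * pi * m * d) - 1) * S) / m\<^sup>2"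
      unfolding m_def[symmetric] by (simp add: sum_divide_distrib diff_divide_distrib)
    then have "\<bar>?t h\<bar> = \<bar>Re ((cis (2 * pi * m * d) - 1) * S)\<bar> / m\<^sup>2"
      by (simp only: abs_divide abs_power2)
    also have "\<dots> \<le> cmod ((cis (2 * pi * m * d) - 1) * S) / m\<^sup>2"
      by (intro divide_right_mono abs_Re_le_cmod) simp
    also have "\<dots> \<le> (2 * pi / real H * min m (real H)) * E (Suc h) / m\<^sup>2"
    proof (intro divide_right_mono)
      have "cmod (cis (2 * pi * m * d) - 1) \<le> 2 * pi / real H * m"
        using norm_cis_minus_one_le[of "2 * pi * m * d"] m by (simp add: abs_mult d)
      moreover have "cmod (cis (2 * pi * m * d) - 1) \<le> 2 * pi / real H * real H"
        using norm_triangle_ineq4[of "cis (2 * pi * m * d)" 1] pi_ge_two Hp by simp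
      ultimately have "cmod (cis (2 * pi * m * d) - 1) \<le> 2 * pi / real H * min m (real H)"
        by (simp add: min_def)
      then show "cmod ((cis (2 * pi * m * d) - 1) * S) \<le> (2 * pi / real H * min m (real H)) * E (Suc h)"
        unfolding norm_mult using SE E0 m Hp by (intro mult_mono) auto
    qed simp
    also have "\<dots> = 2 * pi / real H * (min m (real H) / m\<^sup>2 * E (Suc h))" by simp
    also have "min m (real H) / m\<^sup>2 = fourier_weight H (Suc h)"
    proof -
      have "1 / m = m / m\<^sup>2" using m by (simp add: power2_eq_square)
      then show ?thesis unfolding fourier_weight_def m_def[symmetric] by (simp add: min_divide_distrib_right)
    qed
    finally show ?thesis .
  qed
  have "\<bar>\<Sum>h<n. ?t h\<bar> \<le> 2 * pi / real H * W" for n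
  proof -
    have "\<bar>\<Sum>h<n. ?t h\<bar> \<le> (\<Sum>h<n. \<bar>?t h\<bar>)" by (rule sum_abs)
    also have "\<dots> \<le> (\<Sum>h<n. 2 * pi / real H * (fourier_weight H (Suc h) * E (Suc h)))"
      by (rule sum_mono) (rule term_le)
    also have "\<dots> = 2 * pi / real H * (\<Sum>h<n. fourier_weight H (Suc h) * E (Suc h))"
      by (rule sum_distrib_left[symmetric])
    also have "\<dots> \<le> 2 * pi / real H * W" using W Hp by (intro mult_left_mono) auto
    finally show ?thesis .
  qed
  then have "\<bar>pi\<^sup>2 * ?D\<bar> \<le> 2 * pi / real H * W" by (intro LIMSEQ_le_const2[OF lim]) auto
  then have "pi * (pi * \<bar>?D\<bar>) \<le> pi * (2 * W / real H)"
    by (simp add: abs_mult power2_eq_square mult_ac)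
  then have "pi * \<bar>?D\<bar> \<le> 2 * W / real H" by (simp only: mult_le_cancel_left_pos[OF pi_gt_zero])
  moreover have "1 * \<bar>?D\<bar> \<le> pi * \<bar>?D\<bar>" using pi_ge_two by (intro mult_right_mono) auto
  ultimately show ?thesis by linarith
qed

text \<open>An inequality of Erdoes-Turan type: sums of the sawtooth are reduced to exponential sums, at the cost of
\<open>card I / (2 * H)\<close> for replacing the sawtooth by its averages.\<close>

lemma sawtooth_sum_le:
  fixes x :: "'b \<Rightarrow> real"
  assumes H: "H \<ge> 1"
    and E: "\<And>h. h \<ge> 1 \<Longrightarrow> cmod (\<Sum>i\<in>I. cis (2 * pi * (real h * x i))) \<le> E h"
    and W: "\<And>n. (\<Sum>h<n. fourier_weight H (Suc h) * E (Suc h)) \<le> W"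
  shows "\<bar>\<Sum>i\<in>I. sawtooth (x i)\<bar> \<le> real (card I) / (2 * real H) + W"
proof -
  define \<delta> where "\<delta> = 1 / real H"
  have \<delta>: "0 < \<delta>" "\<delta> \<le> 1" using H by (auto simp: \<delta>_def)
  have H\<delta>: "real H * \<delta> = 1" using H by (simp add: \<delta>_def)
  have 1: "\<bar>\<Sum>i\<in>I. bernoulli2 (x i + \<delta>) - bernoulli2 (x i)\<bar> \<le> 2 * W * \<delta>"
    using bernoulli2_increment_sum[OF H _ E W, of \<delta>] by (simp add: \<delta>_def)
  have 2: "\<bar>\<Sum>i\<in>I. bernoulli2 (x i + - \<delta>) - bernoulli2 (x i)\<bar> \<le> 2 * W * \<delta>"
    using bernoulli2_increment_sum[OF H _ E W, of "- \<delta>"] by (simp add: \<delta>_def)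
  have "(\<Sum>i\<in>I. (bernoulli2 (x i + \<delta>) - bernoulli2 (x i)) / (2 * \<delta>) - \<delta> / 2) \<le> (\<Sum>i\<in>I. sawtooth (x i))"
    by (intro sum_mono sawtooth_lower \<delta>)
  moreover have "(\<Sum>i\<in>I. (bernoulli2 (x i + \<delta>) - bernoulli2 (x i)) / (2 * \<delta>) - \<delta> / 2)
     = (\<Sum>i\<in>I. bernoulli2 (x i + \<delta>) - bernoulli2 (x i)) / (2 * \<delta>) - card I * (\<delta> / 2)"
    by (simp add: sum_subtractf[of "\<lambda>i. (bernoulli2 (x i + \<delta>) - bernoulli2 (x i)) / (2 * \<delta>)"] sum_divide_distrib)
  moreover have "(\<Sum>i\<in>I. bernoulli2 (x i + \<delta>) - bernoulli2 (x i)) / (2 * \<delta>) \<ge> - W"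
    using 1 \<delta> by (simp add: pos_le_divide_eq)
  moreover have "(\<Sum>i\<in>I. sawtooth (x i)) \<le>
      (\<Sum>i\<in>I. (bernoulli2 (x i) - bernoulli2 (x i - \<delta>)) / (2 * \<delta>) + \<delta> / 2)"
    by (intro sum_mono sawtooth_upper \<delta>)
  moreover have "(\<Sum>i\<in>I. (bernoulli2 (x i) - bernoulli2 (x i - \<delta>)) / (2 * \<delta>) + \<delta> / 2)
     = (- (\<Sum>i\<in>I. bernoulli2 (x i + - \<delta>) - bernoulli2 (x i))) / (2 * \<delta>) + card I * (\<delta> / 2)"
    by (simp add: sum.distrib sum_divide_distrib sum_negf[symmetric])
  moreover have "(- (\<Sum>i\<in>I. bernoulli2 (x i + - \<delta>) - bernoulli2 (x i))) / (2 * \<delta>) \<le> W"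
  proof -
    have "- (\<Sum>i\<in>I. bernoulli2 (x i + - \<delta>) - bernoulli2 (x i)) \<le> W * (2 * \<delta>)" using 2 by linarith
    then show ?thesis using \<delta> by (simp only: pos_divide_le_eq zero_less_mult_iff zero_less_numeral simp_thms)
  qed
  moreover have "card I * (\<delta> / 2) = real (card I) / (2 * real H)" by (simp add: \<delta>_def)
  ultimately show ?thesis by linarith
qed

lemma inverse_sqrt_le_diff:
  fixes m :: real
  assumes "m \<ge> 0"
  shows "1 / sqrt (m + 1) \<le> 2 * sqrt (m + 1) - 2 * sqrt m"
proof -
  define a b where "a = sqrt m" and "b = sqrt (m + 1)"
  have ab: "0 \<le> a" "a \<le> b" "0 < b" "b * b - a * a = 1" using assms by (auto simp: a_def b_def)
  have "1 = (b - a) * (b + a)" using ab(4) by (simp add: algebra_simps)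
  also have "\<dots> \<le> (b - a) * (2 * b)" using ab by (intro mult_left_mono) auto
  finally have "1 / b \<le> (b - a) * (2 * b) / b" using ab by (intro divide_right_mono) auto
  then have "1 / b \<le> 2 * b - 2 * a" using ab by simp
  then show ?thesis by (simp add: a_def b_def)
qed

lemma inverse_three_halves_le_diff:
  fixes m :: real
  assumes "m > 0"
  shows "1 / ((m + 1) * sqrt (m + 1)) \<le> 2 / sqrt m - 2 / sqrt (m + 1)"
proof -
  define a b where "a = sqrt m" and "b = sqrt (m + 1)"
  have ab: "0 < a" "a \<le> b" "0 < b" "b * b - a * a = 1" "m + 1 = b * b"
    using assms by (auto simp: a_def b_def)
  have "1 / b \<le> 2 * b - 2 * a"
    using inverse_sqrt_le_diff[of m] assms by (simp add: a_def b_def)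
  then have "1 / b / (b * b) \<le> (2 * b - 2 * a) / (b * b)" using ab by (intro divide_right_mono) auto
  also have "\<dots> \<le> (2 * b - 2 * a) / (a * b)" using ab by (intro divide_left_mono mult_right_mono) auto
  also have "\<dots> = 2 / a - 2 / b" using ab by (simp add: field_simps)
  finally show ?thesis using ab by (simp add: a_def[symmetric] b_def[symmetric] mult_ac)
qed

lemma sum_inverse_three_halves:
  "(\<Sum>h<n. 1 / (real (Suc h) * sqrt (real (Suc h)))) \<le> 3"
proof -
  have "(\<Sum>h<Suc n. 1 / (real (Suc h) * sqrt (real (Suc h)))) \<le> 3 - 2 / sqrt (real (Suc n))" for n
  proof (induction n)
    case (Suc n)
    have "1 / (real (Suc (Suc n)) * sqrt (real (Suc (Suc n))))
       \<le> 2 / sqrt (real (Suc n)) - 2 / sqrt (real (Suc (Suc n)))"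
      using inverse_three_halves_le_diff[of "real (Suc n)"] by (simp add: add_ac)
    then show ?case using Suc by simp
  qed simp
  note * = this
  show ?thesis
  proof (cases n)
    case (Suc k)
    have "2 / sqrt (real (Suc k)) \<ge> 0" by simp
    then show ?thesis using *[of k] unfolding Suc by linarith
  qed simp
qed

text \<open>The bound \<open>\<Phi>\<close> telescopes: it grows like \<open>2 * sqrt m\<close> up to \<open>H\<close> and its increments are those of \<open>- 2 * H / sqrt m\<close> afterwards, the two
pieces agreeing at \<open>m = H\<close>.\<close>

lemma fourier_weight_sqrt_sum:
  assumes "H \<ge> 1"
  shows "(\<Sum>h<n. fourier_weight H (Suc h) * sqrt (real (Suc h))) \<le> 4 * sqrt (real H)"
proof -
  define \<Phi> where "\<Phi> m = (if m \<le> H then 2 * sqrt (real m) else 4 * sqrt (real H) - 2 * real H / sqrt (real m))" for m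
  have "(\<Sum>h<n. fourier_weight H (Suc h) * sqrt (real (Suc h))) \<le> \<Phi> n"
  proof (induction n)
    case (Suc n)
    have "fourier_weight H (Suc n) * sqrt (real (Suc n)) \<le> \<Phi> (Suc n) - \<Phi> n"
    proof (cases "Suc n \<le> H")
      case True
      have "fourier_weight H (Suc n) * sqrt (real (Suc n)) \<le> 1 / real (Suc n) * sqrt (real (Suc n))"
        by (intro mult_right_mono) (auto simp: fourier_weight_def)
      also have "\<dots> = 1 / sqrt (real (Suc n))"
        by (simp add: real_div_sqrt field_simps del: of_nat_Suc)
      also have "\<dots> \<le> 2 * sqrt (real (Suc n)) - 2 * sqrt (real n)"
        using inverse_sqrt_le_diff[of "real n"] by (simp add: add_ac)
      finally show ?thesis using True by (simp add: \<Phi>_def)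
    next
      case False
      then have n: "n \<ge> H" "n > 0" using assms by auto
      have "fourier_weight H (Suc n) * sqrt (real (Suc n)) \<le> real H / (real (Suc n))\<^sup>2 * sqrt (real (Suc n))"
        by (intro mult_right_mono) (auto simp: fourier_weight_def)
      also have "\<dots> = real H * (1 / (real (Suc n) * sqrt (real (Suc n))))"
        by (simp add: power2_eq_square real_div_sqrt field_simps del: of_nat_Suc)
      also have "\<dots> \<le> real H * (2 / sqrt (real n) - 2 / sqrt (real (Suc n)))"
        using inverse_three_halves_le_diff[of "real n"] n by (intro mult_left_mono) (auto simp: add_ac)
      also have "\<dots> = \<Phi> (Suc n) - \<Phi> n"
      proof (cases "n = H")
        case True
        have "real H * 2 / sqrt (real H) = 2 * sqrt (real H)"
        proof -
          have "real H * 2 / sqrt (real H) = (real H / sqrt (real H)) * 2" by simp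
          then show ?thesis using real_div_sqrt[of "real H"] by simp
        qed
        then show ?thesis using True by (simp add: \<Phi>_def right_diff_distrib)
      next
        case False
        then show ?thesis using n by (simp add: \<Phi>_def right_diff_distrib mult.commute)
      qed
      finally show ?thesis .
    qed
    then show ?case using Suc by simp
  qed (simp add: \<Phi>_def)
  also have "\<Phi> n \<le> 4 * sqrt (real H)"
  proof -
    have "0 \<le> 2 * real H / sqrt (real n)" by simp
    moreover have "2 * sqrt (real n) \<le> 4 * sqrt (real H)" if "n \<le> H"
    proof -
      have "sqrt (real n) \<le> sqrt (real H)" "0 \<le> sqrt (real H)" using that by simp_all
      then show ?thesis by linarith
    qed
    ultimately show ?thesis by (auto simp: \<Phi>_def)
  qed
  finally show ?thesis .
qed

lemma fourier_weight_le:
  assumes "m \<ge> 1"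
  shows "fourier_weight H m \<le> sqrt (real H) * (1 / (real m * sqrt (real m)))"
proof -
  define a b where "a = sqrt (real m)" and "b = sqrt (real H)"
  have ab: "a > 0" "b \<ge> 0" "real m = a * a" "real H = b * b" using assms by (auto simp: a_def b_def)
  have a3: "real m * sqrt (real m) = a * a * a" by (simp add: ab(3)[symmetric] a_def[symmetric])
  show ?thesis
  proof (cases "a \<le> b")
    case True
    have "fourier_weight H m \<le> 1 / (a * a)" by (simp add: fourier_weight_def ab)
    also have "\<dots> \<le> b * (1 / (a * a * a))" using True ab by (simp add: field_simps)
    finally show ?thesis using ab(1) a3 by (simp add: b_def[symmetric])
  next
    case False
    have "fourier_weight H m \<le> (b * b) / (a * a)\<^sup>2" by (simp add: fourier_weight_def ab)
    also have "\<dots> \<le> (b * a) / (a * a)\<^sup>2" using False ab by (intro divide_right_mono mult_left_mono) auto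
    also have "\<dots> = b * (1 / (a * a * a))" using ab by (simp add: field_simps power2_eq_square)
    finally show ?thesis using ab(1) a3 by (simp add: b_def[symmetric])
  qed
qed

lemma fourier_weight_sum: "(\<Sum>h<n. fourier_weight H (Suc h)) \<le> 3 * sqrt (real H)"
proof -
  have "(\<Sum>h<n. fourier_weight H (Suc h)) \<le> (\<Sum>h<n. sqrt (real H) * (1 / (real (Suc h) * sqrt (real (Suc h)))))"
    by (intro sum_mono fourier_weight_le) simp
  also have "\<dots> = sqrt (real H) * (\<Sum>h<n. 1 / (real (Suc h) * sqrt (real (Suc h))))"
    by (rule sum_distrib_left[symmetric])
  also have "\<dots> \<le> sqrt (real H) * 3" by (intro mult_left_mono sum_inverse_three_halves) simp
  finally show ?thesis by simp
qed

lemma fourier_weight_inverse_sqrt_sum: "(\<Sum>h<n. fourier_weight H (Suc h) / sqrt (real (Suc h))) \<le> 3"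
proof -
  have "(\<Sum>h<n. fourier_weight H (Suc h) / sqrt (real (Suc h)))
      \<le> (\<Sum>h<n. 1 / (real (Suc h) * sqrt (real (Suc h))))"
  proof (intro sum_mono)
    fix h
    have "fourier_weight H (Suc h) / sqrt (real (Suc h)) \<le> 1 / real (Suc h) / sqrt (real (Suc h))"
      by (intro divide_right_mono) (auto simp: fourier_weight_def)
    then show "fourier_weight H (Suc h) / sqrt (real (Suc h)) \<le> 1 / (real (Suc h) * sqrt (real (Suc h)))"
      by simp
  qed
  also have "\<dots> \<le> 3" by (rule sum_inverse_three_halves)
  finally show ?thesis .
qed

text \<open>The second difference test for \<open>- h * x\<close>, whose differences increase. The sum for \<open>h * x\<close> is the complex
conjugate. Since \<open>M\<close> terms have only \<open>M - 1\<close> differences, the last term is added separately.\<close>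

lemma concave_exponential_sum:
  fixes x :: "nat \<Rightarrow> real"
  assumes \<mu>: "0 < \<mu>" and T: "0 \<le> T" and h: "h \<ge> 1"
    and gap: "\<And>m n. m \<le> n \<Longrightarrow> Suc n < M \<Longrightarrow>
          \<mu> * real (n - m) \<le> (x (Suc m) - x m) - (x (Suc n) - x n)"
    and T': "\<And>n. Suc n < M \<Longrightarrow> x (Suc 0) - x 0 - T \<le> x (Suc n) - x n"
  shows "cmod (\<Sum>n<M. cis (2 * pi * (real h * x n)))
     \<le> 18 / sqrt \<mu> * (T * sqrt (real h) + 1 / sqrt (real h)) + 2"
proof -
  define N where "N = M - 1"
  define y where "y n = - (real h * x n)" for n
  have hp: "real h > 0" using h by simp
  have "cmod (\<Sum>n<N. cis (2 * pi * y n)) \<le> 18 * (real h * T + 1) / sqrt (real h * \<mu>) + 1"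
  proof (rule second_difference_test)
    show "0 < real h * \<mu>" "0 \<le> real h * T" using \<mu> T hp by auto
    fix n assume n: "n < N"
    have "real h * (x (Suc 0) - x 0 - T) \<le> real h * (x (Suc n) - x n)"
      using T'[of n] n hp by (intro mult_left_mono) (auto simp: N_def)
    then show "y (Suc n) - y n \<le> y (Suc 0) - y 0 + real h * T"
      by (simp add: y_def algebra_simps)
    fix m assume m: "m \<le> n"
    have "real h * (\<mu> * real (n - m)) \<le> real h * ((x (Suc m) - x m) - (x (Suc n) - x n))"
      using gap[OF m] n hp by (intro mult_left_mono) (auto simp: N_def)
    then show "real h * \<mu> * real (n - m) \<le> y (Suc n) - y n - (y (Suc m) - y m)"
      by (simp add: y_def algebra_simps)
  qed
  also have "18 * (real h * T + 1) / sqrt (real h * \<mu>) = 18 / sqrt \<mu> * (T * sqrt (real h) + 1 / sqrt (real h))"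
  proof -
    define a where "a = sqrt (real h)"
    have a: "a > 0" "real h = a * a" using hp by (auto simp: a_def)
    show ?thesis unfolding real_sqrt_mult a_def[symmetric] unfolding a(2) using a(1) \<mu> by (simp add: field_simps)
  qed
  also have "(\<Sum>n<N. cis (2 * pi * y n)) = cnj (\<Sum>n<N. cis (2 * pi * (real h * x n)))"
    unfolding cnj_sum by (simp add: y_def cis_cnj)
  finally have *: "cmod (\<Sum>n<N. cis (2 * pi * (real h * x n)))
      \<le> 18 / sqrt \<mu> * (T * sqrt (real h) + 1 / sqrt (real h)) + 1" unfolding complex_mod_cnj .
  show ?thesis
  proof (cases M)
    case 0 then show ?thesis using \<mu> T by simp
  next
    case (Suc k)
    have "cmod (\<Sum>n<M. cis (2 * pi * (real h * x n))) \<le> cmod (\<Sum>n<N. cis (2 * pi * (real h * x n))) + 1"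
      using norm_triangle_ineq[of "\<Sum>n<N. cis (2 * pi * (real h * x n))" "cis (2 * pi * (real h * x N))"]
      by (simp add: N_def Suc)
    then show ?thesis using * by linarith
  qed
qed

text \<open>The truncation \<open>H\<close> of order \<open>\<mu> powr (-1/3)\<close> balances the smoothing cost \<open>M / H\<close>, where \<open>M\<close> is at most \<open>T / \<mu> + 2\<close>,
against the main part \<open>T * sqrt (H / \<mu>)\<close> of the exponential sums.\<close>

lemma sawtooth_sum_concave:
  fixes x :: "nat \<Rightarrow> real"
  assumes \<mu>: "0 < \<mu>" "\<mu> \<le> 1" and T: "0 \<le> T"
    and gap: "\<And>m n. m \<le> n \<Longrightarrow> Suc n < M \<Longrightarrow>
          \<mu> * real (n - m) \<le> (x (Suc m) - x m) - (x (Suc n) - x n)"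
    and T': "\<And>n. Suc n < M \<Longrightarrow> x (Suc 0) - x 0 - T \<le> x (Suc n) - x n"
  shows "\<bar>\<Sum>n<M. sawtooth (x n)\<bar> \<le> 145 * T * \<mu> powr (-2/3) + 67 * \<mu> powr (-1/2)"
proof -
  \<comment> \<open>Rounding up at most doubles a number that is at least one; the cruder factor four below has a rational square root.\<close>
  define H where "H = nat \<lceil>\<mu> powr (-1/3)\<rceil>"
  have one: "1 \<le> \<mu> powr (-1/3)" using \<mu> powr_mono2[of "1/3" \<mu> 1] by (simp add: powr_minus_divide)
  have H1: "\<mu> powr (-1/3) \<le> real H" using one unfolding H_def by linarith
  have H2: "real H \<le> 4 * \<mu> powr (-1/3)" using one unfolding H_def by linarith
  have H: "H \<ge> 1" using H1 one by linarith
  have sH: "sqrt (real H) \<le> 2 * \<mu> powr (-1/6)"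
  proof -
    have "sqrt (real H) \<le> sqrt (4 * \<mu> powr (-1/3))" using H2 by simp
    also have "\<dots> = 2 * \<mu> powr (-1/6)"
      by (simp add: real_sqrt_mult powr_half_sqrt[symmetric] powr_powr)
    finally show ?thesis .
  qed
  have s\<mu>: "1 / sqrt \<mu> = \<mu> powr (-1/2)" using \<mu> by (simp add: powr_half_sqrt[symmetric] powr_minus_divide)
  define E where "E h = 18 / sqrt \<mu> * (T * sqrt (real h) + 1 / sqrt (real h)) + 2" for h :: nat
  define W where "W = 18 / sqrt \<mu> * (T * (4 * sqrt (real H)) + 3) + 2 * (3 * sqrt (real H))"
  have "(\<Sum>h<n. fourier_weight H (Suc h) * E (Suc h)) \<le> W" for n
  proof -
    let ?w = "\<lambda>h. fourier_weight H (Suc h)"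
    have "(\<Sum>h<n. ?w h * E (Suc h)) =
      (\<Sum>h<n. 18 / sqrt \<mu> * (T * (?w h * sqrt (real (Suc h))) + ?w h / sqrt (real (Suc h))) + 2 * ?w h)"
      by (intro sum.cong) (auto simp: E_def algebra_simps)
    also have "\<dots> = 18 / sqrt \<mu> * (T * (\<Sum>h<n. ?w h * sqrt (real (Suc h))) + (\<Sum>h<n. ?w h / sqrt (real (Suc h))))
        + 2 * (\<Sum>h<n. ?w h)"
      by (simp only: sum.distrib sum_distrib_left distrib_left)
    also have "\<dots> \<le> W"
      unfolding W_def
      by (intro add_mono mult_left_mono fourier_weight_sqrt_sum[OF H] fourier_weight_sum fourier_weight_inverse_sqrt_sum)
         (use T \<mu> in auto)
    finally show ?thesis .
  qed
  then have "\<bar>\<Sum>n<M. sawtooth (x n)\<bar> \<le> real (card {..<M}) / (2 * real H) + W"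
  proof (intro sawtooth_sum_le[OF H])
    fix h :: nat assume "h \<ge> 1"
    from concave_exponential_sum[OF \<mu>(1) T this, of M x] gap T'
    show "cmod (\<Sum>n<M. cis (2 * pi * (real h * x n))) \<le> E h" unfolding E_def by blast
  qed
  moreover have "W \<le> 144 * T * \<mu> powr (-2/3) + 66 * \<mu> powr (-1/2)"
  proof -
    have "W = 72 * T * (1 / sqrt \<mu>) * sqrt (real H) + 54 * (1 / sqrt \<mu>) + 6 * sqrt (real H)"
      by (simp add: W_def algebra_simps)
    also have "\<dots> \<le> 72 * T * \<mu> powr (-1/2) * (2 * \<mu> powr (-1/6)) + 54 * \<mu> powr (-1/2) + 6 * (2 * \<mu> powr (-1/2))"
      unfolding s\<mu>
    proof (intro add_mono mult_left_mono sH)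
      have "\<mu> powr (-1/6) \<le> \<mu> powr (-1/2)" using \<mu> by (intro powr_mono') auto
      then show "sqrt (real H) \<le> 2 * \<mu> powr (-1/2)" using sH by linarith
    qed (use T in auto)
    also have "72 * T * \<mu> powr (-1/2) * (2 * \<mu> powr (-1/6)) = 144 * T * \<mu> powr (-2/3)"
      by (simp add: powr_add[symmetric])
    finally show ?thesis by simp
  qed
  moreover have "real (card {..<M}) / (2 * real H) \<le> T * \<mu> powr (-2/3) + \<mu> powr (-1/2)"
  proof -
    have M: "real M \<le> T / \<mu> + 2"
    proof (cases "M \<le> 2")
      case True
      have "0 \<le> T / \<mu>" using T \<mu> by simp
      then show ?thesis using True by linarith
    next
      case False
      have "\<mu> * real (M - 2) \<le> (x (Suc 0) - x 0) - (x (Suc (M - 2)) - x (M - 2))"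
        using gap[of 0 "M - 2"] False by simp
      also have "\<dots> \<le> T"
      proof -
        have "Suc (M - 2) < M" using False by linarith
        from T'[OF this] show ?thesis by linarith
      qed
      finally show ?thesis using \<mu> False by (simp add: field_simps of_nat_diff)
    qed
    have "real M / (2 * real H) \<le> (T / \<mu> + 2) / (2 * \<mu> powr (-1/3))"
      using M H1 one T \<mu> by (intro frac_le) auto
    also have "\<dots> = T / \<mu> * \<mu> powr (1/3) / 2 + \<mu> powr (1/3)"
      using \<mu> by (simp add: powr_minus field_simps)
    also have "T / \<mu> * \<mu> powr (1/3) = T * \<mu> powr (-2/3)"
      using \<mu> powr_diff[of \<mu> "1/3" 1] by simp
    also have "T * \<mu> powr (-2/3) / 2 \<le> T * \<mu> powr (-2/3)" using T by simp
    also have "\<mu> powr (1/3) \<le> \<mu> powr (-1/2)" using \<mu> by (intro powr_mono') auto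
    finally show ?thesis by simp
  qed
  ultimately show ?thesis by linarith
qed

section \<open>The quarter arc of the unit p-circle\<close>

lemma sawtooth_sum_concave_function:
  fixes f f' :: "real \<Rightarrow> real"
  assumes \<mu>: "0 < \<mu>" "\<mu> \<le> 1" and \<Lambda>: "0 \<le> \<Lambda>" and L: "real b - real (Suc a) \<le> L" "0 \<le> L"
    and deriv: "\<And>y. real (Suc a) \<le> y \<Longrightarrow> y \<le> real b \<Longrightarrow> (f has_real_derivative f' y) (at y)"
    and lower: "\<And>u v. real (Suc a) \<le> u \<Longrightarrow> u \<le> v \<Longrightarrow> v \<le> real b \<Longrightarrow> \<mu> * (v - u) \<le> f' u - f' v"
    and upper: "\<And>u v. real (Suc a) \<le> u \<Longrightarrow> u \<le> v \<Longrightarrow> v \<le> real b \<Longrightarrow> f' u - f' v \<le> \<Lambda> * (v - u)"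
  shows "\<bar>\<Sum>k\<in>{a<..b}. sawtooth (f (real k))\<bar>
     \<le> 145 * (\<Lambda> * L) * \<mu> powr (-2/3) + 67 * \<mu> powr (-1/2)"
proof -
  define x where "x n = f (real (Suc a + n))" for n
  have "(\<Sum>k\<in>{a<..b}. sawtooth (f (real k))) = (\<Sum>n<b - a. sawtooth (x n))"
    unfolding x_def
    by (intro sum.reindex_bij_witness[of _ "\<lambda>n. Suc a + n" "\<lambda>k. k - Suc a"]) auto
  also have "\<bar>\<dots>\<bar> \<le> 145 * (\<Lambda> * L) * \<mu> powr (-2/3) + 67 * \<mu> powr (-1/2)"
  proof (rule sawtooth_sum_concave[OF \<mu>])
    show "0 \<le> \<Lambda> * L" using \<Lambda> L by simp
  next
    fix m n assume mn: "m \<le> n" "Suc n < b - a"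
    show "\<mu> * real (n - m) \<le> (x (Suc m) - x m) - (x (Suc n) - x n)"
    proof (cases "m = n")
      case False
      define u v where "u = real (Suc a + m)" and "v = real (Suc a + n)"
      have uv: "u < v" "real (Suc a) \<le> u" "v + 1 \<le> real b" using mn False by (auto simp: u_def v_def)
      have "\<exists>z. u < z \<and> z < v \<and> (f (v + 1) - f v) - (f (u + 1) - f u) = (v - u) * (f' (z + 1) - f' z)"
      proof (rule MVT2[OF uv(1)])
        fix y assume "u \<le> y" "y \<le> v"
        then have "(f has_real_derivative f' (y + 1)) (at (y + 1))" "(f has_real_derivative f' y) (at y)"
          using uv by (auto intro!: deriv)
        then show "((\<lambda>y. f (y + 1) - f y) has_real_derivative f' (y + 1) - f' y) (at y)"
          by (intro DERIV_diff) (simp_all only: DERIV_shift)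
      qed
      then obtain z where z: "u < z" "z < v"
        "(f (v + 1) - f v) - (f (u + 1) - f u) = (v - u) * (f' (z + 1) - f' z)" by blast
      have "\<mu> \<le> f' z - f' (z + 1)" using lower[of z "z + 1"] z uv by simp
      then have "(v - u) * \<mu> \<le> (v - u) * (f' z - f' (z + 1))" using uv by (intro mult_left_mono) auto
      also have "\<dots> = (f (u + 1) - f u) - (f (v + 1) - f v)" using z(3) by (simp add: algebra_simps)
      finally show ?thesis using mn by (simp add: u_def v_def x_def of_nat_diff algebra_simps)
    qed simp
  next
    fix n assume n: "Suc n < b - a"
    define u v where "u = real (Suc a)" and "v = real (Suc a + n)"
    have uv: "u \<le> v" "v + 1 \<le> real b" using n by (auto simp: u_def v_def)
    have "\<exists>z. u < z \<and> z < u + 1 \<and> f (u + 1) - f u = (u + 1 - u) * f' z"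
      by (rule MVT2) (use uv in \<open>auto intro!: deriv simp: u_def\<close>)
    then obtain y where y: "u < y" "y < u + 1" "f (u + 1) - f u = f' y" by auto
    have "\<exists>z. v < z \<and> z < v + 1 \<and> f (v + 1) - f v = (v + 1 - v) * f' z"
      by (rule MVT2) (use uv in \<open>auto intro!: deriv simp: u_def\<close>)
    then obtain z where z: "v < z" "z < v + 1" "f (v + 1) - f v = f' z" by auto
    have "f' y - f' z \<le> \<Lambda> * L"
    proof (cases "y \<le> z")
      case True
      have "f' y - f' z \<le> \<Lambda> * (z - y)" using upper[of y z] True y z uv by (simp add: u_def)
      also have "\<dots> \<le> \<Lambda> * L" using L \<Lambda> y z uv by (intro mult_left_mono) (auto simp: u_def)
      finally show ?thesis .
    next
      case False
      have "\<mu> * (y - z) \<le> f' z - f' y" using lower[of z y] False y z uv by (simp add: u_def)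
      moreover have "0 \<le> \<mu> * (y - z)" using \<mu> False by simp
      moreover have "0 \<le> \<Lambda> * L" using L \<Lambda> by simp
      ultimately show ?thesis by linarith
    qed
    then have "f (u + 1) - f u - \<Lambda> * L \<le> f (v + 1) - f v" using y z by linarith
    then show "x (Suc 0) - x 0 - \<Lambda> * L \<le> x (Suc n) - x n"
      by (simp add: x_def u_def v_def add_ac)
  qed
  finally show ?thesis .
qed

definition quarter_arc :: "real \<Rightarrow> real \<Rightarrow> real" where
  "quarter_arc p t = (1 - t powr p) powr (1/p)"

definition arc_slope :: "real \<Rightarrow> real \<Rightarrow> real" where
  "arc_slope p t = - (t powr (p - 1) * (1 - t powr p) powr (1/p - 1))"

definition arc_bend :: "real \<Rightarrow> real \<Rightarrow> real" where
  "arc_bend p t = - ((p - 1) * t powr (p - 2) * (1 - t powr p) powr (1/p - 2))"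

text \<open>The point with both coordinates \<open>diagonal p\<close> lies on the unit \<open>p\<close>-circle.\<close>

definition diagonal :: "real \<Rightarrow> real" where
  "diagonal p = (1/2) powr (1/p)"

text \<open>With \<open>e = min (1/6) (1/(2*p))\<close>, this is \<open>1 - 2 * e\<close>.\<close>

definition error_exponent :: "real \<Rightarrow> real" where
  "error_exponent p = max (2/3) (1 - 1/p)"

context
  fixes p :: real
  assumes p: "1 < p"
begin

lemma powr_less_one: "0 \<le> t \<Longrightarrow> t < 1 \<Longrightarrow> t powr p < 1"
  using p powr_less_mono2[of p t 1] by simp

lemma arc_deriv:
  assumes "0 < t" "t < 1"
  shows "(quarter_arc p has_real_derivative arc_slope p t) (at t)"
proof -
  have "1 - t powr p > 0" using powr_less_one[of t] assms by simp
  then show ?thesis unfolding quarter_arc_def[abs_def]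
    using assms p
    by (auto intro!: derivative_eq_intros simp: arc_slope_def powr_diff field_simps)
qed

lemma arc_slope_deriv:
  assumes "0 < t" "t < 1"
  shows "(arc_slope p has_real_derivative arc_bend p t) (at t)"
proof -
  define u where "u = 1 - t powr p"
  have u: "u > 0" using powr_less_one[of t] assms by (simp add: u_def)
  have "(arc_slope p has_real_derivative
     - ((p - 1) * t powr (p - 2) * u powr (1/p - 1)
         + t powr (p - 1) * ((1/p - 1) * u powr (1/p - 2) * (- p * t powr (p - 1))))) (at t)"
    unfolding arc_slope_def[abs_def]
    using assms u unfolding u_def
    by (auto intro!: derivative_eq_intros)
  also have "- ((p - 1) * t powr (p - 2) * u powr (1/p - 1)
         + t powr (p - 1) * ((1/p - 1) * u powr (1/p - 2) * (- p * t powr (p - 1)))) = arc_bend p t"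
  proof -
    have 1: "u powr (1/p - 1) = u * u powr (1/p - 2)"
      using u powr_add[of u 1 "1/p - 2"] by simp
    have 2: "t powr (p - 1) * t powr (p - 1) = t powr (p - 2) * t powr p"
      by (simp add: powr_add[symmetric])
    have 3: "(1/p - 1) * (- p) = p - 1" using p by (simp add: field_simps)
    have "t powr (p - 1) * ((1/p - 1) * u powr (1/p - 2) * (- p * t powr (p - 1)))
       = ((1/p - 1) * (- p)) * (t powr (p - 1) * t powr (p - 1)) * u powr (1/p - 2)" by (simp only: mult_ac)
    also have "\<dots> = (p - 1) * (t powr (p - 2) * t powr p) * u powr (1/p - 2)" unfolding 2 3 ..
    finally have "(p - 1) * t powr (p - 2) * u powr (1/p - 1)
         + t powr (p - 1) * ((1/p - 1) * u powr (1/p - 2) * (- p * t powr (p - 1)))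
       = (p - 1) * t powr (p - 2) * u powr (1/p - 2) * (u + t powr p)"
      unfolding 1 by (simp add: algebra_simps)
    then show ?thesis by (simp add: arc_bend_def u_def)
  qed
  finally show ?thesis .
qed

lemma diagonal_bounds: "0 < diagonal p" "diagonal p < 1" "1/2 \<le> diagonal p"
  "diagonal p powr p = 1/2"
proof -
  show "0 < diagonal p" by (simp add: diagonal_def)
  show "diagonal p < 1" unfolding diagonal_def using p powr_less_mono2[of "1/p" "1/2" 1] by simp
  have "(1/2) powr 1 \<le> (1/2::real) powr (1/p)" using p by (intro powr_mono') auto
  then show "1/2 \<le> diagonal p" by (simp add: diagonal_def)
  show "diagonal p powr p = 1/2" using p by (simp add: diagonal_def powr_powr)
qed

lemma one_minus_powr_bounds:
  assumes "0 \<le> t" "t \<le> diagonal p"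
  shows "1/2 \<le> 1 - t powr p" "1 - t powr p \<le> 1"
  using powr_mono2[of p t "diagonal p"] assms p diagonal_bounds(4) by auto

lemma arc_diagonal: "quarter_arc p (diagonal p) = diagonal p"
  unfolding quarter_arc_def diagonal_bounds(4) by (simp add: diagonal_def)

text \<open>Up to the diagonal point, the factor \<open>1 - t powr p\<close> stays between \<open>1/2\<close> and \<open>1\<close>, so that only the behaviour at the
axis \<open>t = 0\<close> counts.\<close>

lemma arc_bend_bounds:
  assumes "0 < t" "t \<le> diagonal p"
  shows "(p - 1) * t powr (p - 2) \<le> - arc_bend p t" "- arc_bend p t \<le> 4 * (p - 1) * t powr (p - 2)"
proof -
  define u where "u = 1 - t powr p"
  have u: "1/2 \<le> u" "u \<le> 1" using one_minus_powr_bounds[of t] assms by (auto simp: u_def)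
  have e: "1/p - 2 \<le> 0" "- 2 \<le> 1/p - 2" using p by (auto simp: field_simps)
  have "u powr 0 \<le> u powr (1/p - 2)" using u e by (intro powr_mono') auto
  then have l: "1 \<le> u powr (1/p - 2)" using u by simp
  have "u powr (1/p - 2) \<le> u powr (- 2)" using u e by (intro powr_mono') auto
  also have "\<dots> \<le> (1/2) powr (- 2)" using u by (intro powr_mono2') auto
  also have "(1/2::real) powr (- 2) = 4" by (simp add: powr_minus_divide powr_numeral power2_eq_square)
  finally have h: "u powr (1/p - 2) \<le> 4" .
  have eq: "- arc_bend p t = (p - 1) * t powr (p - 2) * u powr (1/p - 2)" by (simp add: arc_bend_def u_def)
  have nn: "0 \<le> (p - 1) * t powr (p - 2)" using p by simp
  show "(p - 1) * t powr (p - 2) \<le> - arc_bend p t" "- arc_bend p t \<le> 4 * (p - 1) * t powr (p - 2)"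
    unfolding eq using mult_left_mono[OF l nn] mult_left_mono[OF h nn] by (simp_all only: mult_ac mult_1_right)
qed

lemma powr_within_octave:
  fixes a t \<tau> :: real
  assumes "\<tau> / 2 \<le> t" "t \<le> \<tau>" "0 < \<tau>"
  shows "\<tau> powr a / 2 powr \<bar>a\<bar> \<le> t powr a" "t powr a \<le> 2 powr \<bar>a\<bar> * \<tau> powr a"
proof -
  define v where "v = \<tau> / t"
  have t: "t > 0" using assms by simp
  have v: "1 \<le> v" "v \<le> 2" using assms t by (auto simp: v_def field_simps)
  have \<tau>: "\<tau> = v * t" using t by (simp add: v_def)
  have up: "v powr b \<le> 2 powr \<bar>a\<bar>" if "b \<le> \<bar>a\<bar>" "0 \<le> \<bar>a\<bar>" for b
  proof -
    have "v powr b \<le> v powr \<bar>a\<bar>" using v that by (intro powr_mono) auto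
    also have "\<dots> \<le> 2 powr \<bar>a\<bar>" using v by (intro powr_mono2) auto
    finally show ?thesis .
  qed
  have "v powr a * t powr a \<le> 2 powr \<bar>a\<bar> * t powr a" using up[of a] by (intro mult_right_mono) auto
  then show "\<tau> powr a / 2 powr \<bar>a\<bar> \<le> t powr a"
    using t v by (simp add: \<tau> powr_mult pos_divide_le_eq mult.commute)
  have "v powr (- a) * \<tau> powr a \<le> 2 powr \<bar>a\<bar> * \<tau> powr a" using up[of "- a"] by (intro mult_right_mono) auto
  moreover have "v powr (- a) * \<tau> powr a = t powr a"
    using t v by (simp add: \<tau> powr_mult powr_minus)
  ultimately show "t powr a \<le> 2 powr \<bar>a\<bar> * \<tau> powr a" by simp
qed

text \<open>On the octave between \<open>\<tau> / 2\<close> and \<open>\<tau>\<close>, the second derivative \<open>s ^ 3 / r * arc_bend p t\<close> of the scaled arc has constant order of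
magnitude \<open>\<tau> powr (p - 2) / r\<close> for bounded \<open>s\<close> and \<open>1 / s\<close>.\<close>

lemma scaled_slope_decrease:
  assumes "0 < r" "0 < s" "0 < \<tau>" "\<tau> \<le> diagonal p"
    and "\<tau> / 2 * (r / s) \<le> u" "u \<le> v" "v \<le> \<tau> * (r / s)"
  defines "q \<equiv> 2 powr \<bar>p - 2\<bar>"
  shows "s ^ 3 / r * ((p - 1) * (\<tau> powr (p - 2) / q)) * (v - u)
           \<le> s\<^sup>2 * arc_slope p (u * s / r) - s\<^sup>2 * arc_slope p (v * s / r)"
    and "s\<^sup>2 * arc_slope p (u * s / r) - s\<^sup>2 * arc_slope p (v * s / r)
           \<le> s ^ 3 / r * (4 * (p - 1) * (q * \<tau> powr (p - 2))) * (v - u)"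
proof -
  let ?d = "s\<^sup>2 * arc_slope p (u * s / r) - s\<^sup>2 * arc_slope p (v * s / r)"
  have "s ^ 3 / r * ((p - 1) * (\<tau> powr (p - 2) / q)) * (v - u) \<le> ?d \<and>
        ?d \<le> s ^ 3 / r * (4 * (p - 1) * (q * \<tau> powr (p - 2))) * (v - u)"
  proof (cases "u = v")
    case False
    define U V where "U = u * s / r" and "V = v * s / r"
    have UV: "U < V" "\<tau> / 2 \<le> U" "V \<le> \<tau>" using assms False by (auto simp: U_def V_def field_simps)
    have "\<exists>z. U < z \<and> z < V \<and> arc_slope p V - arc_slope p U = (V - U) * arc_bend p z"
    proof (rule MVT2[OF UV(1)])
      fix y assume "U \<le> y" "y \<le> V"
      then show "(arc_slope p has_real_derivative arc_bend p y) (at y)"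
        using UV assms diagonal_bounds by (intro arc_slope_deriv) auto
    qed
    then obtain z where z: "U < z" "z < V" "arc_slope p V - arc_slope p U = (V - U) * arc_bend p z" by blast
    have "?d = s\<^sup>2 * (- (arc_slope p V - arc_slope p U))"
      by (simp add: U_def V_def algebra_simps)
    also have "\<dots> = s ^ 3 / r * (v - u) * (- arc_bend p z)"
      unfolding z(3) using assms by (simp add: U_def V_def power2_eq_square power3_eq_cube field_simps)
    finally have d: "?d = s ^ 3 / r * (v - u) * (- arc_bend p z)" .
    have zt: "\<tau> / 2 \<le> z" "z \<le> \<tau>" "0 < z" "z \<le> diagonal p" using z UV assms by auto
    have c: "0 \<le> s ^ 3 / r * (v - u)" using assms by simp
    have "(p - 1) * (\<tau> powr (p - 2) / q) \<le> (p - 1) * z powr (p - 2)"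
      using powr_within_octave(1)[OF zt(1,2) assms(3), of "p - 2"] p unfolding q_def by (intro mult_left_mono) auto
    also have "\<dots> \<le> - arc_bend p z" by (rule arc_bend_bounds[OF zt(3,4)])
    finally have 1: "(p - 1) * (\<tau> powr (p - 2) / q) \<le> - arc_bend p z" .
    have "- arc_bend p z \<le> 4 * (p - 1) * z powr (p - 2)" by (rule arc_bend_bounds[OF zt(3,4)])
    also have "\<dots> \<le> 4 * (p - 1) * (q * \<tau> powr (p - 2))"
      using powr_within_octave(2)[OF zt(1,2) assms(3), of "p - 2"] p unfolding q_def by (intro mult_left_mono) auto
    finally have 2: "- arc_bend p z \<le> 4 * (p - 1) * (q * \<tau> powr (p - 2))" .
    show ?thesis unfolding d using mult_left_mono[OF 1 c] mult_left_mono[OF 2 c] by (simp only: mult_ac conj_absorb)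
  qed simp
  then show "s ^ 3 / r * ((p - 1) * (\<tau> powr (p - 2) / q)) * (v - u) \<le> ?d"
    "?d \<le> s ^ 3 / r * (4 * (p - 1) * (q * \<tau> powr (p - 2))) * (v - u)" by auto
qed

lemma scaled_arc_deriv:
  assumes "0 < r" "0 < s" "0 < y" "y * s < r"
  shows "((\<lambda>y. r * s * quarter_arc p (y * s / r)) has_real_derivative s\<^sup>2 * arc_slope p (y * s / r)) (at y)"
proof -
  have "((\<lambda>y. quarter_arc p (y * s / r)) has_real_derivative arc_slope p (y * s / r) * (s / r)) (at y)"
    using assms by (intro DERIV_chain2[OF arc_deriv]) (auto intro!: derivative_eq_intros)
  then have "((\<lambda>y. r * s * quarter_arc p (y * s / r)) has_real_derivative r * s * (arc_slope p (y * s / r) * (s / r))) (at y)"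
    by (rule DERIV_cmult)
  then show ?thesis using assms by (simp add: power2_eq_square field_simps)
qed

text \<open>The concave bound with \<open>\<mu>\<close> of order \<open>w = \<tau> powr (p - 2) / r\<close> and slope variation of order \<open>w * \<tau> * r\<close>.
The hypothesis on \<open>\<tau> powr (p - 2)\<close> ensures \<open>\<mu> \<le> 1\<close>; it matters for \<open>p < 2\<close>, where the curvature is unbounded at the axis.\<close>

lemma arc_octave_sawtooth:
  assumes K: "1 \<le> K"
  obtains C where "0 < C"
    "\<And>r s \<tau>. 1 \<le> r \<Longrightarrow> 1 / K \<le> s \<Longrightarrow> s \<le> K \<Longrightarrow> 0 < \<tau> \<Longrightarrow> \<tau> \<le> diagonal p \<Longrightarrow> \<tau> powr (p - 2) \<le> 2 * r \<Longrightarrow>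
      \<bar>\<Sum>k\<in>{nat \<lfloor>\<tau> / 2 * (r / s)\<rfloor><..nat \<lfloor>\<tau> * (r / s)\<rfloor>}. sawtooth (r * s * quarter_arc p (real k * s / r))\<bar>
        \<le> C * (r powr (2/3) * \<tau> powr ((p + 1)/3) + r powr (1/2) * \<tau> powr (1 - p/2))"
proof -
  define q where "q = 2 powr \<bar>p - 2\<bar>"
  have q: "q \<ge> 1" unfolding q_def by (intro ge_one_powr_ge_zero) auto
  \<comment> \<open>The upper and lower curvature bounds are \<open>D * w\<close> and \<open>c * w\<close>. Since \<open>w \<le> 2\<close>, the cap \<open>1/2\<close> on \<open>c\<close> keeps the lower one below \<open>1\<close>.\<close>
  define c where "c = min (1/2) ((p - 1) / (q * K ^ 3))"
  have c: "0 < c" using p q K by (simp add: c_def)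
  have c2: "c \<le> 1/2" unfolding c_def by (rule min.cobounded1)
  define D where "D = 4 * (p - 1) * q * K ^ 3"
  have D: "0 < D" using p q K by (auto simp: D_def)
  define C where "C = 145 * D * K * c powr (-2/3) + 67 * c powr (-1/2)"
  have C: "0 < C" using D c K by (auto simp: C_def intro!: add_pos_pos)
  show ?thesis
  proof (rule that[OF C])
    fix r s \<tau> :: real
    assume r: "1 \<le> r" and s: "1 / K \<le> s" "s \<le> K" and \<tau>: "0 < \<tau>" "\<tau> \<le> diagonal p" and \<tau>r: "\<tau> powr (p - 2) \<le> 2 * r"
    have s0: "0 < s" using s K by (smt (verit) divide_pos_pos)
    define a b where "a = nat \<lfloor>\<tau> / 2 * (r / s)\<rfloor>" and "b = nat \<lfloor>\<tau> * (r / s)\<rfloor>"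
    define w where "w = \<tau> powr (p - 2) / r"
    have w: "0 < w" "w \<le> 2" using \<tau> r \<tau>r by (auto simp: w_def field_simps)
    have a: "\<tau> / 2 * (r / s) \<le> real (Suc a)" unfolding a_def by linarith
    have b: "real b \<le> \<tau> * (r / s)" using \<tau> r s0 unfolding b_def by (simp add: of_nat_nat)
    have sK: "s ^ 3 \<le> K ^ 3" using s s0 by (intro power_mono) auto
    have sK': "1 / K ^ 3 \<le> s ^ 3" using power_mono[OF s(1), of 3] K by (simp add: power_divide)
    have RK: "r / s \<le> K * r"
    proof -
      have "1 \<le> s * K" using s K by (simp add: field_simps)
      then have "r * 1 \<le> r * (s * K)" using r by (intro mult_left_mono) auto
      then show ?thesis using s0 by (simp add: pos_divide_le_eq mult_ac)
    qed
    have "\<bar>\<Sum>k\<in>{a<..b}. sawtooth (r * s * quarter_arc p (real k * s / r))\<bar>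
      \<le> 145 * (D * w * (\<tau> * (K * r))) * (c * w) powr (-2/3) + 67 * (c * w) powr (-1/2)"
    proof (rule sawtooth_sum_concave_function[where f' = "\<lambda>y. s\<^sup>2 * arc_slope p (y * s / r)"])
      show "0 < c * w" using c w by simp
      have "c * w \<le> 1/2 * 2" using c c2 w by (intro mult_mono) auto
      then show "c * w \<le> 1" by simp
      show "0 \<le> D * w" using D w by simp
      show "0 \<le> \<tau> * (K * r)" using \<tau> K r by simp
      have "\<tau> * (r / s) \<le> \<tau> * (K * r)" using RK \<tau> by (intro mult_left_mono) auto
      then show "real b - real (Suc a) \<le> \<tau> * (K * r)" using b by simp
    next
      fix y assume y: "real (Suc a) \<le> y" "y \<le> real b"
      have "y \<le> \<tau> * (r / s)" using y b by linarith
      then have "y * s \<le> \<tau> * r" using s0 by (simp add: field_simps)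
      also have "\<tau> * r < 1 * r" using \<tau> diagonal_bounds r by (intro mult_strict_right_mono) auto
      finally have "y * s < r" by simp
      then show "((\<lambda>y. r * s * quarter_arc p (y * s / r)) has_real_derivative s\<^sup>2 * arc_slope p (y * s / r)) (at y)"
        using r s0 y by (intro scaled_arc_deriv) auto
    next
      fix u v assume uv: "real (Suc a) \<le> u" "u \<le> v" "v \<le> real b"
      have uv': "\<tau> / 2 * (r / s) \<le> u" "v \<le> \<tau> * (r / s)" using uv a b by linarith+
      have r0: "0 < r" using r by simp
      note sd = scaled_slope_decrease[OF r0 s0 \<tau> uv'(1) uv(2) uv'(2), folded q_def]
      have "c \<le> s ^ 3 * ((p - 1) / q)"
      proof -
        have "c \<le> (p - 1) / (q * K ^ 3)" by (simp add: c_def)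
        also have "\<dots> = 1 / K ^ 3 * ((p - 1) / q)" by simp
        also have "\<dots> \<le> s ^ 3 * ((p - 1) / q)" using sK' p q by (intro mult_right_mono) auto
        finally show ?thesis .
      qed
      then have "c * (w * (v - u)) \<le> s ^ 3 * ((p - 1) / q) * (w * (v - u))"
        using w uv by (intro mult_right_mono) auto
      also have "\<dots> = s ^ 3 / r * ((p - 1) * (\<tau> powr (p - 2) / q)) * (v - u)" by (simp add: w_def mult_ac)
      also note sd(1)
      finally show "c * w * (v - u) \<le> s\<^sup>2 * arc_slope p (u * s / r) - s\<^sup>2 * arc_slope p (v * s / r)" by (simp add: mult.assoc)
      note sd(2)
      also have "s ^ 3 / r * (4 * (p - 1) * (q * \<tau> powr (p - 2))) * (v - u)
        = s ^ 3 * (4 * (p - 1) * q * (w * (v - u)))" by (simp add: w_def)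
      also have "\<dots> \<le> K ^ 3 * (4 * (p - 1) * q * (w * (v - u)))"
        using sK p q w uv by (intro mult_right_mono) auto
      also have "\<dots> = D * w * (v - u)" by (simp add: D_def)
      finally show "s\<^sup>2 * arc_slope p (u * s / r) - s\<^sup>2 * arc_slope p (v * s / r) \<le> D * w * (v - u)" .
    qed
    also have "\<dots> = 145 * D * K * c powr (-2/3) * (w * \<tau> * r * w powr (-2/3)) + 67 * c powr (-1/2) * w powr (-1/2)"
      using c w by (simp add: powr_mult mult_ac)
    also have "w * \<tau> * r * w powr (-2/3) = r powr (2/3) * \<tau> powr ((p + 1)/3)"
    proof -
      have "w * w powr (-2/3) = w powr (1/3)" using w powr_add[of w 1 "-2/3"] by simp
      also have "\<dots> = \<tau> powr ((p - 2)/3) / r powr (1/3)" using \<tau> r by (simp add: w_def powr_divide powr_powr)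
      finally have "w * \<tau> * r * w powr (-2/3) = (\<tau> * \<tau> powr ((p - 2)/3)) * (r / r powr (1/3))" by (simp add: mult_ac)
      also have "r / r powr (1/3) = r powr (2/3)" using r powr_diff[of r 1 "1/3"] by simp
      also have "\<tau> * \<tau> powr ((p - 2)/3) = \<tau> powr ((p + 1)/3)"
        using \<tau> powr_add[of \<tau> 1 "(p - 2)/3"] by (simp add: field_simps)
      finally show ?thesis by (simp add: mult_ac)
    qed
    also have "w powr (-1/2) = r powr (1/2) * \<tau> powr (1 - p/2)"
    proof -
      have "w powr (-1/2) = \<tau> powr ((p - 2) * (-1/2)) / r powr (-1/2)"
        using \<tau> r by (simp add: w_def powr_divide powr_powr)
      also have "(p - 2) * (-1/2) = 1 - p/2" by (simp add: field_simps)
      also have "\<tau> powr (1 - p/2) / r powr (-1/2) = r powr (1/2) * \<tau> powr (1 - p/2)" using r by (simp add: powr_minus field_simps)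
      finally show ?thesis .
    qed
    also have "145 * D * K * c powr (-2/3) * (r powr (2/3) * \<tau> powr ((p + 1)/3))
        + 67 * c powr (-1/2) * (r powr (1/2) * \<tau> powr (1 - p/2))
      \<le> C * (r powr (2/3) * \<tau> powr ((p + 1)/3)) + C * (r powr (1/2) * \<tau> powr (1 - p/2))"
      using D K by (intro add_mono mult_right_mono) (auto simp: C_def)
    finally show "\<bar>\<Sum>k\<in>{nat \<lfloor>\<tau> / 2 * (r / s)\<rfloor><..nat \<lfloor>\<tau> * (r / s)\<rfloor>}. sawtooth (r * s * quarter_arc p (real k * s / r))\<bar>
        \<le> C * (r powr (2/3) * \<tau> powr ((p + 1)/3) + r powr (1/2) * \<tau> powr (1 - p/2))"
      unfolding a_def b_def by (simp add: distrib_left)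
  qed
qed

end

section \<open>Summation over octaves\<close>

context
  fixes p :: real
  assumes p: "1 < p"
begin

text \<open>Over the octaves \<open>\<tau> = diagonal p / 2 ^ i\<close>, the second term of \<open>arc_octave_sawtooth\<close> is of order \<open>r powr (1/2) * 2 powr (i * (p/2 - 1))\<close>, a geometric
sequence that need not increase. Raising the exponent to at least \<open>p/6\<close> makes it increase strictly, so that the last octave
dominates; this lemma shows that the raised exponent leads exactly to \<open>error_exponent p\<close>.\<close>

lemma error_exponent_eq: "1/2 + max (p/2 - 1) (p/6) / p = error_exponent p"
proof -
  have "max (p/2 - 1) (p/6) / p = max ((p/2 - 1) / p) ((p/6) / p)"
    using p by (intro max_divide_distrib_right[THEN trans]) auto
  then show ?thesis using p by (auto simp: error_exponent_def max_def field_simps)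
qed

lemma error_exponent_ge: "2/3 \<le> error_exponent p" "1 - 1/p \<le> error_exponent p"
  by (auto simp: error_exponent_def)

lemma power_powr: "0 < y \<Longrightarrow> (y ^ i) powr e = (y powr e) ^ i" for y e :: real
  by (induction i) (auto simp: powr_mult)

lemma dyadic_scale:
  fixes X :: real
  assumes "1 \<le> X"
  obtains I :: nat where "X \<le> 2 ^ I" "2 ^ I \<le> 2 * X" "\<And>i. i < I \<Longrightarrow> 2 ^ i < X"
proof -
  define I where "I = (LEAST n. X \<le> 2 ^ n)"
  have ex: "\<exists>n. X \<le> 2 ^ n" using real_arch_pow[of 2 X] by (auto intro: less_imp_le)
  have 1: "X \<le> 2 ^ I" unfolding I_def using ex by (rule LeastI_ex)
  have 2: "2 ^ i < X" if "i < I" for i using that not_less_Least unfolding I_def by force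
  have "2 ^ I \<le> 2 * X"
  proof (cases I)
    case (Suc k) then show ?thesis using 2[of k] by simp
  qed (use assms in simp)
  with 1 2 show ?thesis by (intro that)
qed

lemma dyadic_decomposition:
  fixes g :: "nat \<Rightarrow> real" and N :: "nat \<Rightarrow> nat"
  assumes "\<And>i. N (Suc i) \<le> N i"
  shows "\<bar>\<Sum>k\<in>{0<..N 0}. g k\<bar> \<le> \<bar>\<Sum>k\<in>{0<..N I}. g k\<bar> + (\<Sum>i<I. \<bar>\<Sum>k\<in>{N (Suc i)<..N i}. g k\<bar>)"
proof (induction I)
  case (Suc I)
  have "{0<..N I} = {0<..N (Suc I)} \<union> {N (Suc I)<..N I}" using assms[of I] by auto
  then have "(\<Sum>k\<in>{0<..N I}. g k) = (\<Sum>k\<in>{0<..N (Suc I)}. g k) + (\<Sum>k\<in>{N (Suc I)<..N I}. g k)"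
    by (simp add: sum.union_disjoint)
  then show ?case using Suc by simp
qed simp

text \<open>The octaves are taken down to abscissa \<open>r powr (- 1/p)\<close> on the unit scale. In the first term of their bounds the widest
octave dominates and contributes \<open>r powr (2/3)\<close>; in the second it is the narrowest one, by \<open>error_exponent_eq\<close>.\<close>

lemma arc_sawtooth_sum:
  assumes K: "1 \<le> K"
  obtains C where "0 < C"
    "\<And>r s. 1 \<le> r \<Longrightarrow> 1 / K \<le> s \<Longrightarrow> s \<le> K \<Longrightarrow>
      \<bar>\<Sum>k\<in>{0<..nat \<lfloor>diagonal p * (r / s)\<rfloor>}. sawtooth (r * s * quarter_arc p (real k * s / r))\<bar>
        \<le> C * r powr error_exponent p"
proof -
  from arc_octave_sawtooth[OF p K] obtain C where C: "0 < C" and octave: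
    "\<And>r s \<tau>. 1 \<le> r \<Longrightarrow> 1 / K \<le> s \<Longrightarrow> s \<le> K \<Longrightarrow> 0 < \<tau> \<Longrightarrow> \<tau> \<le> diagonal p \<Longrightarrow> \<tau> powr (p - 2) \<le> 2 * r \<Longrightarrow>
      \<bar>\<Sum>k\<in>{nat \<lfloor>\<tau> / 2 * (r / s)\<rfloor><..nat \<lfloor>\<tau> * (r / s)\<rfloor>}. sawtooth (r * s * quarter_arc p (real k * s / r))\<bar>
        \<le> C * (r powr (2/3) * \<tau> powr ((p + 1)/3) + r powr (1/2) * \<tau> powr (1 - p/2))"
    by blast
  define x where "x = (1/2::real) powr ((p + 1)/3)"
  have x: "0 < x" "x < 1" using p powr_less_mono2[of "(p + 1)/3" "1/2" 1] by (auto simp: x_def)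
  define \<beta> where "\<beta> = max (p/2 - 1) (p/6)"
  have \<beta>: "0 < \<beta>" "- \<beta> \<le> 1 - p/2" using p by (auto simp: \<beta>_def max_def)
  define b where "b = 2 powr \<beta>"
  have b: "1 < b" using \<beta> by (simp add: b_def)
  define D where "D = C * (1 / (1 - x) + 4 powr \<beta> / (b - 1)) + K"
  have D: "0 < D" using C x b K by (auto simp: D_def intro!: add_nonneg_pos mult_nonneg_nonneg)
  show ?thesis
  proof (rule that[OF D])
    fix r s :: real
    assume r: "1 \<le> r" and s: "1 / K \<le> s" "s \<le> K"
    have s0: "0 < s" using s K by (smt (verit) divide_pos_pos)
    have r1p: "1 \<le> r powr (1/p)" using r p by (intro ge_one_powr_ge_zero) auto
    obtain I where I: "r powr (1/p) \<le> 2 ^ I" "2 ^ I \<le> 2 * r powr (1/p)" "\<And>i. i < I \<Longrightarrow> 2 ^ i < r powr (1/p)"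
      using dyadic_scale[OF r1p] by blast
    define \<tau> where "\<tau> i = diagonal p / 2 ^ i" for i :: nat
    define N where "N i = nat \<lfloor>\<tau> i * (r / s)\<rfloor>" for i
    define g where "g k = sawtooth (r * s * quarter_arc p (real k * s / r))" for k :: nat
    have \<tau>: "0 < \<tau> i" "\<tau> i \<le> diagonal p" "\<tau> i \<le> (1/2) ^ i" "(1/2) ^ Suc i \<le> \<tau> i" for i
      using diagonal_bounds[OF p] one_le_power[of "2::real" i]
      by (auto simp: \<tau>_def power_divide field_simps)
    have \<tau>S: "\<tau> (Suc i) = \<tau> i / 2" for i by (simp add: \<tau>_def)
    have N: "N (Suc i) \<le> N i" for i
      unfolding N_def \<tau>S using \<tau>(1)[of i] r s0 by (intro nat_mono floor_mono mult_right_mono) auto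
    have block: "\<bar>\<Sum>k\<in>{N (Suc i)<..N i}. g k\<bar> \<le> C * (r powr (2/3) * x ^ i + r powr (1/2) * b ^ Suc i)" if i: "i < I" for i
    proof -
      have "\<tau> i powr (p - 2) \<le> 2 * r"
      proof (cases "p \<ge> 2")
        case True
        have "\<tau> i powr (p - 2) \<le> 1 powr (p - 2)"
          using True \<tau>[of i] diagonal_bounds[OF p] by (intro powr_mono2) auto
        then show ?thesis using r by simp
      next
        case False
        have "1 / (2 * r powr (1/p)) \<le> 1 / 2 ^ Suc i" using I(3)[OF i] r1p by (intro divide_left_mono mult_pos_pos) auto
        also have "\<dots> \<le> \<tau> i" using \<tau>(4)[of i] by (simp add: power_divide)
        finally have "1 / (2 * r powr (1/p)) \<le> \<tau> i" .
        then have "\<tau> i powr (p - 2) \<le> (1 / (2 * r powr (1/p))) powr (p - 2)"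
          using False r by (intro powr_mono2') auto
        also have "\<dots> = (2 * r powr (1/p)) powr (2 - p)"
          using r by (simp add: powr_divide powr_minus_divide[symmetric])
        also have "\<dots> = 2 powr (2 - p) * r powr ((2 - p)/p)"
          using r by (simp add: powr_mult powr_powr)
        also have "\<dots> \<le> 2 powr 1 * r powr 1"
          using False r p by (intro mult_mono powr_mono) (auto simp: field_simps)
        finally show ?thesis using r by simp
      qed
      from octave[OF r s \<tau>(1) \<tau>(2) this]
      have "\<bar>\<Sum>k\<in>{N (Suc i)<..N i}. g k\<bar>
         \<le> C * (r powr (2/3) * \<tau> i powr ((p + 1)/3) + r powr (1/2) * \<tau> i powr (1 - p/2))"
        by (simp add: N_def g_def \<tau>S)
      also have "\<dots> \<le> C * (r powr (2/3) * x ^ i + r powr (1/2) * b ^ Suc i)"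
      proof (intro mult_left_mono add_mono)
        have "\<tau> i powr ((p + 1)/3) \<le> ((1/2) ^ i) powr ((p + 1)/3)"
          using \<tau>[of i] p by (intro powr_mono2) auto
        then show "\<tau> i powr ((p + 1)/3) \<le> x ^ i" by (simp add: power_powr x_def)
        have "\<tau> i powr (1 - p/2) \<le> \<tau> i powr (- \<beta>)"
          using \<tau>[of i] diagonal_bounds[OF p] \<beta> by (intro powr_mono') auto
        also have "\<dots> \<le> ((1/2) ^ Suc i) powr (- \<beta>)"
          using \<tau>(4)[of i] \<beta> by (intro powr_mono2') auto
        also have "\<dots> = ((1/2) powr (- \<beta>)) ^ Suc i" by (rule power_powr) simp
        also have "(1/2) powr (- \<beta>) = b" by (simp add: b_def powr_minus powr_divide)
        finally show "\<tau> i powr (1 - p/2) \<le> b ^ Suc i" .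
      qed (use C in auto)
      finally show ?thesis .
    qed
    have "(\<Sum>i<I. \<bar>\<Sum>k\<in>{N (Suc i)<..N i}. g k\<bar>)
        \<le> (\<Sum>i<I. C * (r powr (2/3) * x ^ i + r powr (1/2) * b ^ Suc i))"
      by (intro sum_mono block) auto
    also have "\<dots> = C * (r powr (2/3) * (\<Sum>i<I. x ^ i) + r powr (1/2) * (\<Sum>i<I. b ^ Suc i))"
      by (simp only: sum.distrib sum_distrib_left distrib_left)
    also have "\<dots> \<le> C * (r powr error_exponent p * (1 / (1 - x)) + r powr error_exponent p * (4 powr \<beta> / (b - 1)))"
    proof (intro mult_left_mono add_mono)
      have "(\<Sum>i<I. x ^ i) = (1 - x ^ I) / (1 - x)"
        using x geometric_sum[of x I] by (simp add: field_simps)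
      also have "\<dots> \<le> 1 / (1 - x)" using x by (intro divide_right_mono) auto
      finally have "(\<Sum>i<I. x ^ i) \<le> 1 / (1 - x)" .
      then show "r powr (2/3) * (\<Sum>i<I. x ^ i) \<le> r powr error_exponent p * (1 / (1 - x))"
        using r x error_exponent_ge by (intro mult_mono powr_mono sum_nonneg) auto
      have "(\<Sum>i<I. b ^ Suc i) = b * ((b ^ I - 1) / (b - 1))"
        using b by (simp add: geometric_sum[symmetric] sum_distrib_left)
      also have "\<dots> = (b ^ Suc I - b) / (b - 1)" using b by (simp add: field_simps)
      also have "\<dots> \<le> b ^ Suc I / (b - 1)" using b by (intro divide_right_mono) auto
      also have "b ^ Suc I = (2 ^ Suc I) powr \<beta>" unfolding b_def by (rule power_powr[symmetric]) simp
      also have "\<dots> \<le> (4 * r powr (1/p)) powr \<beta>" using I(2) \<beta> by (intro powr_mono2) auto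
      also have "\<dots> = 4 powr \<beta> * r powr (\<beta> / p)" using r by (simp add: powr_mult powr_powr)
      finally have "(\<Sum>i<I. b ^ Suc i) \<le> 4 powr \<beta> * r powr (\<beta> / p) / (b - 1)"
        using b by (simp add: divide_right_mono)
      then have "r powr (1/2) * (\<Sum>i<I. b ^ Suc i) \<le> r powr (1/2) * (4 powr \<beta> * r powr (\<beta> / p) / (b - 1))"
        by (intro mult_left_mono) auto
      also have "\<dots> = r powr (1/2 + \<beta> / p) * (4 powr \<beta> / (b - 1))" by (simp add: powr_add)
      also have "1/2 + \<beta> / p = error_exponent p" unfolding \<beta>_def by (rule error_exponent_eq)
      finally show "r powr (1/2) * (\<Sum>i<I. b ^ Suc i) \<le> r powr error_exponent p * (4 powr \<beta> / (b - 1))" .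
    qed (use C in auto)
    finally have S: "(\<Sum>i<I. \<bar>\<Sum>k\<in>{N (Suc i)<..N i}. g k\<bar>)
      \<le> C * (r powr error_exponent p * (1 / (1 - x)) + r powr error_exponent p * (4 powr \<beta> / (b - 1)))" .
    have "\<bar>\<Sum>k\<in>{0<..N I}. g k\<bar> \<le> (\<Sum>k\<in>{0<..N I}. \<bar>g k\<bar>)" by (rule sum_abs)
    also have "\<dots> \<le> (\<Sum>k\<in>{0<..N I}. 1/2)" unfolding g_def by (intro sum_mono abs_sawtooth_le)
    also have "\<dots> \<le> real (N I)" by simp
    also have "\<dots> \<le> \<tau> I * (r / s)" using \<tau>[of I] r s0 unfolding N_def by (simp add: of_nat_nat)
    also have "\<dots> \<le> 1 / r powr (1/p) * (r * K)"
    proof (intro mult_mono)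
      have "\<tau> I \<le> 1 / 2 ^ I" using \<tau>(3)[of I] by (simp add: power_divide)
      also have "\<dots> \<le> 1 / r powr (1/p)" using I(1) r1p by (intro divide_left_mono mult_pos_pos) auto
      finally show "\<tau> I \<le> 1 / r powr (1/p)" .
      have "1 \<le> s * K" using s K by (simp add: field_simps)
      then have "r * 1 \<le> r * (s * K)" using r by (intro mult_left_mono) auto
      then show "r / s \<le> r * K" using s0 by (simp add: pos_divide_le_eq mult_ac)
    qed (use r s0 in auto)
    also have "\<dots> = K * r powr (1 - 1/p)" using r by (simp add: powr_diff)
    also have "\<dots> \<le> K * r powr error_exponent p"
      using r K error_exponent_ge by (intro mult_left_mono powr_mono) auto
    finally have T: "\<bar>\<Sum>k\<in>{0<..N I}. g k\<bar> \<le> K * r powr error_exponent p" .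
    have "\<bar>\<Sum>k\<in>{0<..N 0}. g k\<bar> \<le> D * r powr error_exponent p"
      using dyadic_decomposition[of N g I, OF N] S T by (simp add: D_def algebra_simps)
    then show "\<bar>\<Sum>k\<in>{0<..nat \<lfloor>diagonal p * (r / s)\<rfloor>}. sawtooth (r * s * quarter_arc p (real k * s / r))\<bar>
        \<le> D * r powr error_exponent p" by (simp add: N_def g_def \<tau>_def)
  qed
qed

end

section \<open>Sums and areas under the arc\<close>

text \<open>A concave function lies above its chord. In this and the next lemma the area is expressed through a primitive \<open>F\<close>.\<close>

lemma unit_trapezoid_le:
  fixes F f f' :: "real \<Rightarrow> real"
  assumes F: "continuous_on {a..a+1} F" "\<And>y. a < y \<Longrightarrow> y < a + 1 \<Longrightarrow> (F has_real_derivative f y) (at y)"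
    and f: "continuous_on {a..a+1} f" "\<And>y. a < y \<Longrightarrow> y < a + 1 \<Longrightarrow> (f has_real_derivative f' y) (at y)"
    and anti: "\<And>u v. a < u \<Longrightarrow> u \<le> v \<Longrightarrow> v < a + 1 \<Longrightarrow> f' v \<le> f' u"
  shows "(f a + f (a + 1)) / 2 \<le> F (a + 1) - F a"
proof -
  have diff: "f differentiable (at y)" if "a < y" "y < a + 1" for y
    using f(2)[OF that] real_differentiable_def by blast
  define l where "l = f (a + 1) - f a"
  have chord: "f a + l * (y - a) \<le> f y" if y: "a < y" "y < a + 1" for y
  proof -
    obtain z1 where z1: "a < z1" "z1 < y" "f y - f a = (y - a) * f' z1"
    proof -
      have "\<exists>l z. a < z \<and> z < y \<and> DERIV f z :> l \<and> f y - f a = (y - a) * l"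
        using y by (intro MVT continuous_on_subset[OF f(1)]) (auto intro: diff)
      then obtain l z where z: "a < z" "z < y" "DERIV f z :> l" "f y - f a = (y - a) * l" by blast
      have "l = f' z" using DERIV_unique[OF z(3) f(2)] z y by auto
      then show thesis using z that by blast
    qed
    obtain z2 where z2: "y < z2" "z2 < a + 1" "f (a + 1) - f y = (a + 1 - y) * f' z2"
    proof -
      have "\<exists>l z. y < z \<and> z < a + 1 \<and> DERIV f z :> l \<and> f (a + 1) - f y = (a + 1 - y) * l"
        using y by (intro MVT continuous_on_subset[OF f(1)]) (auto intro: diff)
      then obtain l z where z: "y < z" "z < a + 1" "DERIV f z :> l" "f (a + 1) - f y = (a + 1 - y) * l" by blast
      have "l = f' z" using DERIV_unique[OF z(3) f(2)] z y by auto
      then show thesis using z that by blast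
    qed
    have "f' z2 \<le> f' z1" using anti z1 z2 y by auto
    then have "(y - a) * (a + 1 - y) * f' z2 \<le> (y - a) * (a + 1 - y) * f' z1"
      using y by (intro mult_left_mono mult_nonneg_nonneg) auto
    then have "(y - a) * (f (a + 1) - f y) \<le> (a + 1 - y) * (f y - f a)" using z1 z2 by (simp add: mult_ac)
    then show ?thesis by (simp add: l_def algebra_simps)
  qed
  have "F a - (f a * a + l * (a - a)\<^sup>2 / 2) \<le> F (a + 1) - (f a * (a + 1) + l * (a + 1 - a)\<^sup>2 / 2)"
  proof (rule DERIV_nonneg_imp_increasing_open[where f = "\<lambda>y. F y - (f a * y + l * (y - a)\<^sup>2 / 2)"])
    fix y assume y: "a < y" "y < a + 1"
    have "((\<lambda>y. F y - (f a * y + l * (y - a)\<^sup>2 / 2)) has_real_derivative f y - (f a + l * (y - a))) (at y)"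
      using y by (auto intro!: derivative_eq_intros F(2))
    moreover have "0 \<le> f y - (f a + l * (y - a))" using chord[OF y] by simp
    ultimately show "\<exists>z. ((\<lambda>y. F y - (f a * y + l * (y - a)\<^sup>2 / 2)) has_real_derivative z) (at y) \<and> 0 \<le> z" by blast
  qed (auto intro!: continuous_intros F(1))
  then show ?thesis by (simp add: l_def field_simps)
qed

text \<open>The function stays below the line of slope \<open>\<alpha>\<close> through its left end, and rises by at least \<open>\<beta>\<close>. When
\<open>\<alpha>\<close> and \<open>\<beta>\<close> are the slopes at the ends of unit intervals, the errors telescope.\<close>

lemma unit_trapezoid_ge:
  fixes F f f' :: "real \<Rightarrow> real"
  assumes F: "continuous_on {a..a+1} F" "\<And>y. a < y \<Longrightarrow> y < a + 1 \<Longrightarrow> (F has_real_derivative f y) (at y)"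
    and f: "continuous_on {a..a+1} f" "\<And>y. a < y \<Longrightarrow> y < a + 1 \<Longrightarrow> (f has_real_derivative f' y) (at y)"
    and bds: "\<And>y. a < y \<Longrightarrow> y < a + 1 \<Longrightarrow> \<beta> \<le> f' y" "\<And>y. a < y \<Longrightarrow> y < a + 1 \<Longrightarrow> f' y \<le> \<alpha>"
  shows "F (a + 1) - F a \<le> (f a + f (a + 1)) / 2 + (\<alpha> - \<beta>) / 2"
proof -
  have diff: "f differentiable (at y)" if "a < y" "y < a + 1" for y
    using f(2)[OF that] real_differentiable_def by blast
  have up: "f y - f a \<le> (y - a) * \<alpha> \<and> (y - a) * \<beta> \<le> f y - f a" if y: "a < y" "y \<le> a + 1" for y
  proof -
    have "\<exists>l z. a < z \<and> z < y \<and> DERIV f z :> l \<and> f y - f a = (y - a) * l"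
      using y by (intro MVT continuous_on_subset[OF f(1)]) (auto intro: diff)
    then obtain l z where z: "a < z" "z < y" "DERIV f z :> l" "f y - f a = (y - a) * l" by blast
    have "l = f' z" using DERIV_unique[OF z(3) f(2)] z y by auto
    then have "\<beta> \<le> l" "l \<le> \<alpha>" using bds z y by auto
    then show ?thesis unfolding z(4) using y by (auto intro!: mult_left_mono)
  qed
  have "F (a + 1) - (f a * (a + 1) + \<alpha> * (a + 1 - a)\<^sup>2 / 2) \<le> F a - (f a * a + \<alpha> * (a - a)\<^sup>2 / 2)"
  proof (rule DERIV_nonpos_imp_decreasing_open[where f = "\<lambda>y. F y - (f a * y + \<alpha> * (y - a)\<^sup>2 / 2)"])
    fix y assume y: "a < y" "y < a + 1"
    have "((\<lambda>y. F y - (f a * y + \<alpha> * (y - a)\<^sup>2 / 2)) has_real_derivative f y - (f a + \<alpha> * (y - a))) (at y)"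
      using y by (auto intro!: derivative_eq_intros F(2))
    moreover have "f y - (f a + \<alpha> * (y - a)) \<le> 0" using up[of y] y by (simp add: mult.commute)
    ultimately show "\<exists>z. ((\<lambda>y. F y - (f a * y + \<alpha> * (y - a)\<^sup>2 / 2)) has_real_derivative z) (at y) \<and> z \<le> 0" by blast
  qed (auto intro!: continuous_intros F(1))
  moreover have "\<beta> \<le> f (a + 1) - f a" using up[of "a + 1"] by simp
  ultimately show ?thesis by (simp add: field_simps)
qed

definition arc_area :: "real \<Rightarrow> real \<Rightarrow> real" where
  "arc_area p x = integral {0..x} (quarter_arc p)"

text \<open>The lattice points under the scaled arc in the columns up to the diagonal point.\<close>

definition column_sum :: "real \<Rightarrow> real \<Rightarrow> real \<Rightarrow> real" where
  "column_sum p r s = (\<Sum>k\<in>{0<..nat \<lfloor>diagonal p * (r / s)\<rfloor>}. of_int \<lfloor>r * s * quarter_arc p (real k * s / r)\<rfloor>)"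

context
  fixes p :: real
  assumes p: "1 < p"
begin

lemma powr_le_one: "0 \<le> t \<Longrightarrow> t \<le> 1 \<Longrightarrow> t powr p \<le> 1"
  using p powr_mono2[of p t 1] by simp

lemma arc_bounds: "0 \<le> t \<Longrightarrow> t \<le> 1 \<Longrightarrow> 0 \<le> quarter_arc p t" "0 \<le> t \<Longrightarrow> t \<le> 1 \<Longrightarrow> quarter_arc p t \<le> 1"
  using powr_le_one[of t] p powr_mono2[of "1/p" "1 - t powr p" 1] by (auto simp: quarter_arc_def)

lemma arc_zero: "quarter_arc p 0 = 1"
  using p by (simp add: quarter_arc_def)

lemma arc_antimono: "0 \<le> t \<Longrightarrow> t \<le> u \<Longrightarrow> u \<le> 1 \<Longrightarrow> quarter_arc p u \<le> quarter_arc p t"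
  unfolding quarter_arc_def using p powr_le_one[of u] powr_mono2[of p t u] by (intro powr_mono2) auto

lemma arc_half_less_one: "quarter_arc p (1/2) < 1"
proof -
  have "(1/2) powr p > 0" "(1/2) powr p \<le> (1::real)" using powr_le_one[of "1/2"] by auto
  then show ?thesis using p powr_less_mono2[of "1/p" "1 - (1/2) powr p" 1] by (simp add: quarter_arc_def)
qed

lemma arc_arc: "0 \<le> t \<Longrightarrow> t \<le> 1 \<Longrightarrow> quarter_arc p (quarter_arc p t) = t"
  using p powr_le_one[of t] by (simp add: quarter_arc_def powr_powr)

lemma arc_continuous: "continuous_on {0..1} (quarter_arc p)"
  unfolding quarter_arc_def[abs_def] using p powr_le_one
  by (intro continuous_on_powr' continuous_intros) auto

lemma arc_slope_antimono:
  assumes "0 \<le> u" "u \<le> v" "v < 1"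
  shows "arc_slope p v \<le> arc_slope p u"
proof -
  have "v powr p < 1" by (rule powr_less_one) (use assms p in auto)
  moreover have "u powr p \<le> v powr p" using assms p by (intro powr_mono2) auto
  ultimately have "(1 - u powr p) powr (1/p - 1) \<le> (1 - v powr p) powr (1/p - 1)"
    using p by (intro powr_mono2') auto
  moreover have "u powr (p - 1) \<le> v powr (p - 1)" using assms p by (intro powr_mono2) auto
  ultimately show ?thesis unfolding arc_slope_def by (auto intro!: mult_mono)
qed

lemma arc_slope_bounds:
  assumes "0 \<le> t" "t \<le> diagonal p"
  shows "- 2 \<le> arc_slope p t" "arc_slope p t \<le> 0"
proof -
  have u: "1/2 \<le> 1 - t powr p" by (rule one_minus_powr_bounds[OF p assms])
  have "(1 - t powr p) powr (1/p - 1) \<le> (1/2) powr (1/p - 1)"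
    using u p by (intro powr_mono2') auto
  also have "\<dots> \<le> (1/2) powr (- 1)" using p by (intro powr_mono') auto
  also have "(1/2::real) powr (- 1) = 2" by (simp add: powr_minus_divide)
  finally have "(1 - t powr p) powr (1/p - 1) \<le> 2" .
  moreover have "t powr (p - 1) \<le> 1 powr (p - 1)"
    using assms diagonal_bounds[OF p] p by (intro powr_mono2) auto
  ultimately have "t powr (p - 1) * (1 - t powr p) powr (1/p - 1) \<le> 1 * 2"
    by (intro mult_mono) auto
  then show "- 2 \<le> arc_slope p t" "arc_slope p t \<le> 0" by (auto simp: arc_slope_def)
qed

lemma arc_area_zero: "arc_area p 0 = 0"
  by (simp add: arc_area_def)

lemma arc_area_continuous: "continuous_on {0..1} (arc_area p)"
  unfolding arc_area_def[abs_def]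
  by (intro indefinite_integral_continuous_1 integrable_continuous_interval arc_continuous)

lemma arc_area_deriv:
  assumes "0 < x" "x < 1"
  shows "(arc_area p has_real_derivative quarter_arc p x) (at x)"
proof -
  have "((\<lambda>x. integral {0..x} (quarter_arc p)) has_real_derivative quarter_arc p x) (at x within {0..1})"
    using assms by (intro integral_has_real_derivative arc_continuous) auto
  moreover have "at x within {0..1} = at x" using assms by (intro at_within_interior) auto
  ultimately show ?thesis by (simp add: arc_area_def[abs_def])
qed

lemma arc_area_mono:
  assumes "0 \<le> x" "x \<le> y" "y \<le> 1"
  shows "arc_area p x \<le> arc_area p y"
proof (rule DERIV_nonneg_imp_increasing_open[OF assms(2)])
  show "\<exists>d. (arc_area p has_real_derivative d) (at z) \<and> 0 \<le> d" if "x < z" "z < y" for z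
    using that assms arc_area_deriv[of z] arc_bounds(1)[of z] by auto
  show "continuous_on {x..y} (arc_area p)"
    using assms by (intro continuous_on_subset[OF arc_area_continuous]) auto
qed

text \<open>The quarter disc is symmetric about the diagonal. Analytically, the sum of the area left of \<open>x\<close> and the area
left of \<open>quarter_arc p x\<close>, reflected, minus the rectangle in which they overlap, has derivative zero.\<close>

lemma arc_area_symmetry: "arc_area p 1 = 2 * arc_area p (diagonal p) - (diagonal p)\<^sup>2"
proof -
  let ?G = "\<lambda>x. x * quarter_arc p x - arc_area p (quarter_arc p x) - arc_area p x"
  let ?c = "diagonal p"
  note c = diagonal_bounds[OF p]
  have arc01: "0 < quarter_arc p x \<and> quarter_arc p x < 1" if "0 < x" "x < 1" for x
  proof -
    have "0 < x powr p" "x powr p < 1" using that powr_less_one[OF p] by auto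
    then show ?thesis using p powr_less_mono2[of "1/p" "1 - x powr p" 1] by (simp add: quarter_arc_def)
  qed
  have cont: "continuous_on {0..?c} ?G"
  proof (intro continuous_intros)
    show "continuous_on {0..?c} (quarter_arc p)" "continuous_on {0..?c} (arc_area p)"
      using c by (auto intro: continuous_on_subset[OF arc_continuous] continuous_on_subset[OF arc_area_continuous])
    then show "continuous_on {0..?c} (\<lambda>x. arc_area p (quarter_arc p x))"
      using c arc_bounds by (intro continuous_on_compose2[OF arc_area_continuous]) auto
  qed
  have der: "(?G has_real_derivative 0) (at x)" if "0 < x" "x < ?c" for x
  proof -
    have x: "0 < x" "x < 1" using that c by auto
    have "((\<lambda>x. arc_area p (quarter_arc p x)) has_real_derivative x * arc_slope p x) (at x)"
      using DERIV_chain2[OF arc_area_deriv arc_deriv[OF p x]] arc01[OF x] arc_arc[of x] x by simp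
    then have "(?G has_real_derivative (1 * quarter_arc p x + arc_slope p x * x) - x * arc_slope p x - quarter_arc p x) (at x)"
      by (intro DERIV_diff DERIV_mult DERIV_ident arc_deriv[OF p x] arc_area_deriv[OF x])
    then show ?thesis by (simp add: mult.commute)
  qed
  have "?G ?c = ?G 0"
    using DERIV_isconst_end[OF c(1) cont] der by simp
  then show ?thesis by (simp add: arc_diagonal[OF p] arc_zero arc_area_zero power2_eq_square)
qed

lemma trapezoid_hypotheses:
  fixes r s :: real
  assumes "0 < r" "0 < s" "0 \<le> a" "a + 1 \<le> r / s"
  shows "continuous_on {a..a+1} (\<lambda>y. r\<^sup>2 * arc_area p (y * s / r))"
    and "continuous_on {a..a+1} (\<lambda>y. r * s * quarter_arc p (y * s / r))"
    and "a < y \<Longrightarrow> y < a + 1 \<Longrightarrow> ((\<lambda>y. r\<^sup>2 * arc_area p (y * s / r)) has_real_derivative r * s * quarter_arc p (y * s / r)) (at y)"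
    and "a < y \<Longrightarrow> y < a + 1 \<Longrightarrow> ((\<lambda>y. r * s * quarter_arc p (y * s / r)) has_real_derivative s\<^sup>2 * arc_slope p (y * s / r)) (at y)"
proof -
  have sub: "y * s / r \<in> {0..1}" if "y \<in> {a..a+1}" for y
  proof -
    have "y \<le> r / s" using that assms by auto
    then show ?thesis using that assms by (auto simp: field_simps)
  qed
  show "continuous_on {a..a+1} (\<lambda>y. r\<^sup>2 * arc_area p (y * s / r))"
    using sub assms by (intro continuous_intros continuous_on_compose2[OF arc_area_continuous]) auto
  show "continuous_on {a..a+1} (\<lambda>y. r * s * quarter_arc p (y * s / r))"
    using sub assms by (intro continuous_intros continuous_on_compose2[OF arc_continuous]) auto
  assume y: "a < y" "y < a + 1"
  have "y < r / s" using y assms by linarith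
  then have ys: "0 < y * s / r" "y * s / r < 1" "y * s < r" using y assms by (auto simp: field_simps)
  have "((\<lambda>y. arc_area p (y * s / r)) has_real_derivative quarter_arc p (y * s / r) * (s / r)) (at y)"
    using ys assms by (intro DERIV_chain2[OF arc_area_deriv]) (auto intro!: derivative_eq_intros)
  then have "((\<lambda>y. r\<^sup>2 * arc_area p (y * s / r)) has_real_derivative r\<^sup>2 * (quarter_arc p (y * s / r) * (s / r))) (at y)"
    by (rule DERIV_cmult)
  then show "((\<lambda>y. r\<^sup>2 * arc_area p (y * s / r)) has_real_derivative r * s * quarter_arc p (y * s / r)) (at y)"
    using assms by (simp add: power2_eq_square field_simps)
  show "((\<lambda>y. r * s * quarter_arc p (y * s / r)) has_real_derivative s\<^sup>2 * arc_slope p (y * s / r)) (at y)"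
    using ys y assms by (intro scaled_arc_deriv[OF p]) auto
qed

lemma scaled_slope_antimono:
  assumes "0 < r" "0 < s" "0 \<le> u" "u \<le> v" "v < r / s"
  shows "s\<^sup>2 * arc_slope p (v * s / r) \<le> s\<^sup>2 * arc_slope p (u * s / r)"
proof -
  have "v * s < r" using assms by (simp add: field_simps)
  then show ?thesis using assms
    by (intro mult_left_mono arc_slope_antimono) (auto simp: divide_right_mono)
qed

text \<open>Trapezoids inscribed in a concave region. The deficit of half the total drop is what produces the term linear in \<open>r\<close>.\<close>

lemma column_heights_le:
  assumes r: "0 < r" and s: "0 < s" and N: "real N \<le> r / s"
  shows "(\<Sum>k\<in>{0<..N}. r * s * quarter_arc p (real k * s / r))
    \<le> r\<^sup>2 * arc_area p (real N * s / r) - (r * s - r * s * quarter_arc p (real N * s / r)) / 2"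
  using N
proof (induction N)
  case 0 then show ?case by (simp add: arc_zero arc_area_zero)
next
  case (Suc N)
  let ?f = "\<lambda>y. r * s * quarter_arc p (y * s / r)" and ?F = "\<lambda>y. r\<^sup>2 * arc_area p (y * s / r)"
  have N: "0 \<le> real N" "real N + 1 \<le> r / s" using Suc.prems by auto
  note h = trapezoid_hypotheses[OF r s N]
  have "(?f (real N) + ?f (real N + 1)) / 2 \<le> ?F (real N + 1) - ?F (real N)"
    by (rule unit_trapezoid_le[OF h(1,3,2,4)])
       ((assumption | (rule scaled_slope_antimono[OF r s]; use N in linarith))+)
  moreover have "(\<Sum>k\<in>{0<..Suc N}. ?f (real k)) = (\<Sum>k\<in>{0<..N}. ?f (real k)) + ?f (real N + 1)"
    proof -
      have "{0<..Suc N} = insert (Suc N) {0<..N}" by auto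
      then show ?thesis by (simp add: add.commute)
    qed
  moreover have "real (Suc N) = real N + 1" by simp
  ultimately show ?case using Suc.IH N by (simp only:) argo
qed

text \<open>The trapezoid errors are bounded by the slope variation, which is finite only away from \<open>t = 1\<close>; this is
why the columns stop at the diagonal point.\<close>

lemma column_heights_ge:
  assumes r: "0 < r" and s: "0 < s" and N: "real N \<le> diagonal p * (r / s)"
  shows "r\<^sup>2 * arc_area p (real N * s / r) - (r * s - r * s * quarter_arc p (real N * s / r)) / 2 - s\<^sup>2
    \<le> (\<Sum>k\<in>{0<..N}. r * s * quarter_arc p (real k * s / r))"
proof -
  let ?f = "\<lambda>y. r * s * quarter_arc p (y * s / r)" and ?F = "\<lambda>y. r\<^sup>2 * arc_area p (y * s / r)"
  let ?f' = "\<lambda>y. s\<^sup>2 * arc_slope p (y * s / r)"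
  have lt: "diagonal p * (r / s) < 1 * (r / s)"
    using diagonal_bounds[OF p] r s by (intro mult_strict_right_mono) auto
  have "?F (real N) - (?f 0 - ?f (real N)) / 2 - (?f' 0 - ?f' (real N)) / 2 \<le> (\<Sum>k\<in>{0<..N}. ?f (real k))"
    using N
  proof (induction N)
    case 0 then show ?case by (simp add: arc_zero arc_area_zero)
  next
    case (Suc N)
    have N: "0 \<le> real N" "real N + 1 \<le> r / s" "real N + 1 < r / s" using Suc.prems lt by auto
    note h = trapezoid_hypotheses[OF r s N(1,2)]
    have "?F (real N + 1) - ?F (real N) \<le> (?f (real N) + ?f (real N + 1)) / 2 + (?f' (real N) - ?f' (real N + 1)) / 2"
      by (rule unit_trapezoid_ge[OF h(1,3,2,4)])
         ((assumption | (rule scaled_slope_antimono[OF r s]; use N in linarith))+)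
    moreover have "(\<Sum>k\<in>{0<..Suc N}. ?f (real k)) = (\<Sum>k\<in>{0<..N}. ?f (real k)) + ?f (real N + 1)"
      proof -
      have "{0<..Suc N} = insert (Suc N) {0<..N}" by auto
      then show ?thesis by (simp add: add.commute)
    qed
    moreover have "real (Suc N) = real N + 1" by simp
    moreover have "real N \<le> diagonal p * (r / s)" using Suc.prems by simp
    ultimately show ?case using Suc.IH by (simp only:) argo
  qed
  moreover have "?f' 0 = 0" using p by (simp add: arc_slope_def)
  moreover have "s\<^sup>2 * (- 2) \<le> ?f' (real N)"
  proof (intro mult_left_mono arc_slope_bounds)
    show "real N * s / r \<le> diagonal p" using N r s by (simp add: field_simps)
  qed (use r s in auto)
  moreover have "?f 0 = r * s" by (simp add: arc_zero)
  ultimately show ?thesis by argo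
qed

text \<open>With \<open>X = diagonal p * (r / s)\<close> and \<open>Y = diagonal p * (r * s)\<close> for the coordinates of the diagonal point,
the columns reach the integer part of \<open>X\<close> only, which leaves out a strip of width \<open>frac X\<close> and height about \<open>Y\<close>.
The slope is bounded there, so that replacing heights by \<open>Y\<close> costs \<open>O(1)\<close>.\<close>

lemma column_sum_asymptotic:
  assumes K: "1 \<le> K"
  obtains C where "0 < C"
    "\<And>r s. 1 \<le> r \<Longrightarrow> 1 / K \<le> s \<Longrightarrow> s \<le> K \<Longrightarrow>
      \<bar>column_sum p r s - (r\<^sup>2 * arc_area p (diagonal p)
          - frac (diagonal p * (r / s)) * (diagonal p * (r * s))
          + (diagonal p * (r * s) - r * s) / 2 - diagonal p * (r / s) / 2)\<bar>
        \<le> C * r powr error_exponent p"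
proof -
  obtain D where D: "0 < D" and saw: "\<And>r s. 1 \<le> r \<Longrightarrow> 1 / K \<le> s \<Longrightarrow> s \<le> K \<Longrightarrow>
      \<bar>\<Sum>k\<in>{0<..nat \<lfloor>diagonal p * (r / s)\<rfloor>}. sawtooth (r * s * quarter_arc p (real k * s / r))\<bar>
        \<le> D * r powr error_exponent p"
    using arc_sawtooth_sum[OF p K] by blast
  show ?thesis
  proof (rule that[of "D + 4 * K\<^sup>2 + 1"])
    show "0 < D + 4 * K\<^sup>2 + 1" using D by (intro add_pos_pos add_pos_nonneg) auto
    fix r s :: real
    assume r: "1 \<le> r" and s: "1 / K \<le> s" "s \<le> K"
    have s0: "0 < s" using s K by (smt (verit) divide_pos_pos)
    have r0: "0 < r" using r by simp
    note c = diagonal_bounds[OF p]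
    define f F where "f y = r * s * quarter_arc p (y * s / r)" and "F y = r\<^sup>2 * arc_area p (y * s / r)" for y
    define X Y where "X = diagonal p * (r / s)" and "Y = diagonal p * (r * s)"
    define n where "n = nat \<lfloor>X\<rfloor>"
    have X0: "0 < X" "X < r / s"
    proof -
      show "0 < X" using c r0 s0 by (simp add: X_def)
      have "X < 1 * (r / s)" unfolding X_def using c r0 s0 by (intro mult_strict_right_mono) auto
      then show "X < r / s" by simp
    qed
    have nX: "real n = X - frac X" using X0 by (simp add: n_def frac_def)
    have fr: "0 \<le> frac X" "frac X < 1" by (auto simp: frac_lt_1)
    have nle: "real n \<le> X" "X < real n + 1" using nX fr by auto
    have XY: "f X = Y" "F X = r\<^sup>2 * arc_area p (diagonal p)" "X * s / r = diagonal p"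
      using r0 s0 by (auto simp: X_def Y_def f_def F_def arc_diagonal[OF p])
    have f_near: "Y \<le> f y \<and> f y \<le> Y + 2 * s\<^sup>2" if y: "real n \<le> y" "y \<le> X" for y
    proof (cases "y = X")
      case True then show ?thesis by (simp add: XY)
    next
      case False
      have yp: "0 \<le> y" using y by linarith
      have "continuous_on {y..X} f"
      proof -
        have "z * s / r \<in> {0..1}" if "z \<in> {y..X}" for z
        proof -
          have "z \<le> r / s" using that X0 by auto
          then show ?thesis using that yp r0 s0 by (auto simp: field_simps)
        qed
        then show ?thesis unfolding f_def using r0
          by (intro continuous_intros continuous_on_compose2[OF arc_continuous]) auto
      qed
      moreover have fd: "(f has_real_derivative s\<^sup>2 * arc_slope p (z * s / r)) (at z)" if "y < z" "z < X" for z
      proof -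
        have "z < r / s" using that X0 by linarith
        then show ?thesis unfolding f_def using that yp r0 s0
          by (intro scaled_arc_deriv[OF p]) (auto simp: field_simps)
      qed
      ultimately have "\<exists>l z. y < z \<and> z < X \<and> DERIV f z :> l \<and> f X - f y = (X - y) * l"
        using False y by (intro MVT) (auto simp: real_differentiable_def)
      then obtain l z where z: "y < z" "z < X" "DERIV f z :> l" "f X - f y = (X - y) * l" by blast
      have l: "l = s\<^sup>2 * arc_slope p (z * s / r)" using DERIV_unique[OF z(3) fd] z by auto
      have zs: "0 \<le> z * s / r" "z * s / r \<le> diagonal p"
        using z yp r0 s0 by (auto simp: X_def field_simps)
      have "s\<^sup>2 * (- 2) \<le> l" "l \<le> s\<^sup>2 * 0"
        unfolding l by (intro mult_left_mono arc_slope_bounds[OF zs]; simp)+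
      then have l': "- (2 * s\<^sup>2) \<le> l" "l \<le> 0" by auto
      have "(X - y) * l \<le> 0" using l' y by (simp add: mult_nonneg_nonpos)
      moreover have "- (2 * s\<^sup>2) \<le> (X - y) * l"
      proof -
        have "(X - y) * (- l) \<le> 1 * (2 * s\<^sup>2)" using l' y nle by (intro mult_mono) auto
        then show ?thesis by simp
      qed
      ultimately show ?thesis using z(4) XY by auto
    qed
    have F_near: "frac X * Y \<le> F X - F (real n) \<and> F X - F (real n) \<le> frac X * Y + 2 * s\<^sup>2"
    proof (cases "real n = X")
      case True
      then have "frac X = 0" using nX by linarith
      then have z: "frac X * Y = 0" by (simp only: mult_zero_left)
      show ?thesis unfolding z True by simp
    next
      case False
      have Fd: "(F has_real_derivative f z) (at z)" if "real n < z" "z < X" for z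
      proof -
        have z: "0 < z" "z < r / s" using that X0 by auto
        then have zs: "0 < z * s / r" "z * s / r < 1" using r0 s0 by (auto simp: field_simps)
        have "((\<lambda>y. arc_area p (y * s / r)) has_real_derivative quarter_arc p (z * s / r) * (s / r)) (at z)"
          using zs r0 by (intro DERIV_chain2[OF arc_area_deriv]) (auto intro!: derivative_eq_intros)
        then have "((\<lambda>y. r\<^sup>2 * arc_area p (y * s / r)) has_real_derivative r\<^sup>2 * (quarter_arc p (z * s / r) * (s / r))) (at z)"
          by (rule DERIV_cmult)
        then show ?thesis using r0 by (simp add: F_def[abs_def] f_def power2_eq_square field_simps)
      qed
      have "continuous_on {real n..X} F"
      proof -
        have "z * s / r \<in> {0..1}" if "z \<in> {real n..X}" for z
        proof -
          have "0 \<le> z" "z \<le> r / s" using that X0 by auto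
          then show ?thesis using r0 s0 by (auto simp: field_simps)
        qed
        then show ?thesis unfolding F_def using r0
          by (intro continuous_intros continuous_on_compose2[OF arc_area_continuous]) auto
      qed
      then have "\<exists>l z. real n < z \<and> z < X \<and> DERIV F z :> l \<and> F X - F (real n) = (X - real n) * l"
        using False nle Fd by (intro MVT) (auto simp: real_differentiable_def)
      then obtain l z where z: "real n < z" "z < X" "DERIV F z :> l" "F X - F (real n) = (X - real n) * l" by blast
      have l: "l = f z" using DERIV_unique[OF z(3) Fd] z by auto
      have eq: "F X - F (real n) = frac X * f z" using z(4) nX l by simp
      have "frac X * Y \<le> frac X * f z" "frac X * f z \<le> frac X * (Y + 2 * s\<^sup>2)"
        using f_near[of z] z fr by (intro mult_left_mono; simp)+
      moreover have "frac X * (2 * s\<^sup>2) \<le> 1 * (2 * s\<^sup>2)" using fr by (intro mult_right_mono) auto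
      ultimately show ?thesis unfolding eq by (simp add: distrib_left)
    qed
    have up: "(\<Sum>k\<in>{0<..n}. f (real k)) \<le> F (real n) - (r * s - f (real n)) / 2"
      using column_heights_le[OF r0 s0, of n] nle X0 by (simp add: f_def F_def)
    have lo: "F (real n) - (r * s - f (real n)) / 2 - s\<^sup>2 \<le> (\<Sum>k\<in>{0<..n}. f (real k))"
      using column_heights_ge[OF r0 s0, of n] nle by (simp add: f_def F_def X_def)
    have "of_int \<lfloor>y\<rfloor> = y - 1/2 - sawtooth y" for y :: real by (simp add: sawtooth_def frac_def)
    then have "column_sum p r s = (\<Sum>k\<in>{0<..n}. f (real k) - 1/2 - sawtooth (f (real k)))"
      by (simp add: column_sum_def f_def n_def X_def)
    also have "\<dots> = (\<Sum>k\<in>{0<..n}. f (real k)) - real n / 2 - (\<Sum>k\<in>{0<..n}. sawtooth (f (real k)))"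
      by (simp add: sum_subtractf)
    finally have cs: "column_sum p r s = (\<Sum>k\<in>{0<..n}. f (real k)) - real n / 2 - (\<Sum>k\<in>{0<..n}. sawtooth (f (real k)))" .
    have sw: "\<bar>\<Sum>k\<in>{0<..n}. sawtooth (f (real k))\<bar> \<le> D * r powr error_exponent p"
      using saw[OF r s] by (simp add: f_def n_def X_def)
    have fn: "Y \<le> f (real n)" "f (real n) \<le> Y + 2 * s\<^sup>2" using f_near[of "real n"] nle by auto
    have "\<bar>column_sum p r s - (F X - frac X * Y + (Y - r * s) / 2 - X / 2)\<bar>
       \<le> D * r powr error_exponent p + 4 * s\<^sup>2 + 1"
      using cs sw fn up lo F_near nX fr by argo
    also have "\<dots> \<le> D * r powr error_exponent p + (4 * K\<^sup>2 + 1) * r powr error_exponent p"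
    proof -
      have "s\<^sup>2 \<le> K\<^sup>2" using s s0 by (intro power_mono) auto
      moreover have "1 \<le> r powr error_exponent p"
        using r error_exponent_ge(1)[OF p] by (intro ge_one_powr_ge_zero) auto
      then have "(4 * K\<^sup>2 + 1) * 1 \<le> (4 * K\<^sup>2 + 1) * r powr error_exponent p" by (intro mult_left_mono) auto
      ultimately show ?thesis by simp
    qed
    also have "\<dots> = (D + 4 * K\<^sup>2 + 1) * r powr error_exponent p" by (simp add: algebra_simps)
    finally show "\<bar>column_sum p r s - (r\<^sup>2 * arc_area p (diagonal p)
          - frac (diagonal p * (r / s)) * (diagonal p * (r * s))
          + (diagonal p * (r * s) - r * s) / 2 - diagonal p * (r / s) / 2)\<bar>
        \<le> (D + 4 * K\<^sup>2 + 1) * r powr error_exponent p" unfolding XY(2) unfolding X_def Y_def .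
  qed
qed

end

section \<open>Lattice points in stretched p-ellipses\<close>

lemma ellipse_points_swap:
  assumes "0 < s"
  shows "ellipse_points p r (1 / s) = prod.swap ` ellipse_points p r s"
proof -
  have "(j, k) \<in> ellipse_points p r (1 / s) \<longleftrightarrow> (k, j) \<in> ellipse_points p r s" for j k
    by (auto simp: ellipse_points_def divide_inverse add.commute)
  then show ?thesis by (force simp: image_iff)
qed

lemma lattice_count_inverse:
  assumes "0 < s"
  shows "lattice_count p r (1 / s) = lattice_count p r s"
  unfolding lattice_count_def ellipse_points_swap[OF assms] by (intro card_image) auto

context
  fixes p :: real
  assumes p: "1 < p"
begin

lemma ellipse_points_column:
  assumes r: "0 < r" and s: "0 < s" and jk: "1 \<le> j" "1 \<le> k" "real j \<le> r / s"
  shows "(j, k) \<in> ellipse_points p r s \<longleftrightarrow> real k \<le> r * s * quarter_arc p (real j * s / r)"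
proof -
  define t y where "t = real j * s / r" and "y = real k / (r * s)"
  have t: "0 \<le> t" "t \<le> 1" using assms by (auto simp: t_def field_simps)
  have y: "0 \<le> y" using assms by (simp add: y_def)
  have js: "(real j * s) powr p = r powr p * t powr p"
  proof -
    have "real j * s = r * t" using r by (simp add: t_def)
    then show ?thesis using r t by (simp add: powr_mult)
  qed
  have ks: "(real k * inverse s) powr p = r powr p * y powr p"
  proof -
    have "real k * inverse s = r * y" using r s by (simp add: y_def field_simps)
    then show ?thesis using r y by (simp add: powr_mult)
  qed
  have "(j, k) \<in> ellipse_points p r s \<longleftrightarrow> r powr p * (t powr p + y powr p) \<le> r powr p * 1"
    using jk unfolding ellipse_points_def by (simp add: js ks distrib_left del: mult_le_cancel_left mult_le_cancel_left1 mult_le_cancel_left2)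
  also have "\<dots> \<longleftrightarrow> y powr p \<le> 1 - t powr p"
    using r by (subst mult_le_cancel_left_pos) auto
  also have "\<dots> \<longleftrightarrow> y \<le> quarter_arc p t"
  proof
    assume "y powr p \<le> 1 - t powr p"
    then have "(y powr p) powr (1/p) \<le> (1 - t powr p) powr (1/p)" using p by (intro powr_mono2) auto
    then show "y \<le> quarter_arc p t" using p y by (simp add: quarter_arc_def powr_powr)
  next
    assume "y \<le> quarter_arc p t"
    then have "y powr p \<le> quarter_arc p t powr p" using p y by (intro powr_mono2) auto
    then show "y powr p \<le> 1 - t powr p"
      using p powr_le_one[OF p t] by (simp add: quarter_arc_def powr_powr)
  qed
  also have "\<dots> \<longleftrightarrow> real k \<le> r * s * quarter_arc p t"
    using r s by (simp add: y_def pos_divide_le_eq mult_ac)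
  finally show ?thesis by (simp add: t_def)
qed

lemma ellipse_point_bound:
  assumes r: "0 < r" and s: "0 < s" and jk: "(j, k) \<in> ellipse_points p r s"
  shows "real j \<le> r / s"
proof -
  have "(real j * s) powr p + (real k * inverse s) powr p \<le> r powr p"
    using jk by (simp add: ellipse_points_def)
  then have "(real j * s) powr p \<le> r powr p"
    using powr_ge_zero[of "real k * inverse s" p] by linarith
  then have "real j * s \<le> r" using r s p by (metis less_imp_le linorder_not_less order_less_trans powr_less_mono2 zero_less_one)
  then show ?thesis using s by (simp add: field_simps)
qed

lemma ellipse_points_columns:
  assumes r: "0 < r" and s: "0 < s" and N: "real N \<le> r / s"
  shows "{(j, k) \<in> ellipse_points p r s. j \<le> N} =
    Sigma {0<..N} (\<lambda>j. {0<..nat \<lfloor>r * s * quarter_arc p (real j * s / r)\<rfloor>})" (is "?L = ?R")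
    and "real (card {(j, k) \<in> ellipse_points p r s. j \<le> N}) =
      (\<Sum>j\<in>{0<..N}. of_int \<lfloor>r * s * quarter_arc p (real j * s / r)\<rfloor>)"
proof -
  have nn: "0 \<le> r * s * quarter_arc p (real j * s / r)" for j
    using r s by (simp add: quarter_arc_def)
  have mem: "(j, k) \<in> ?L \<longleftrightarrow> (j, k) \<in> ?R" for j k
  proof (cases "1 \<le> j \<and> 1 \<le> k \<and> j \<le> N")
    case True
    then have "real j \<le> r / s" using N by (meson of_nat_mono order_trans)
    then have "(j, k) \<in> ?L \<longleftrightarrow> real k \<le> r * s * quarter_arc p (real j * s / r)"
      using ellipse_points_column[OF r s, of j k] True by auto
    also have "\<dots> \<longleftrightarrow> k \<le> nat \<lfloor>r * s * quarter_arc p (real j * s / r)\<rfloor>"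
      using nn[of j] by (simp add: le_nat_iff le_floor_iff)
    finally show ?thesis using True by auto
  next
    case False then show ?thesis by (auto simp: ellipse_points_def)
  qed
  show *: "?L = ?R"
  proof (intro set_eqI)
    fix q :: "nat \<times> nat"
    show "q \<in> ?L \<longleftrightarrow> q \<in> ?R" by (cases q) (simp only: mem)
  qed
  show "real (card ?L) = (\<Sum>j\<in>{0<..N}. of_int \<lfloor>r * s * quarter_arc p (real j * s / r)\<rfloor>)"
    unfolding * using nn by (simp add: of_nat_nat)
qed

text \<open>Beyond the diagonal point in both coordinates, each of the two powers exceeds \<open>r powr p / 2\<close>.\<close>

lemma ellipse_points_near_axis:
  assumes r: "0 < r" and s: "0 < s" and jk: "(j, k) \<in> ellipse_points p r s"
  shows "real j \<le> diagonal p * (r / s) \<or> real k \<le> diagonal p * (r * s)"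
proof (rule ccontr)
  assume "\<not> ?thesis"
  then have g: "diagonal p * r < real j * s" "diagonal p * r < real k * inverse s"
    using r s by (auto simp: field_simps)
  have h: "(diagonal p * r) powr p = r powr p / 2"
    using diagonal_bounds[OF p] r by (simp add: powr_mult)
  have "(diagonal p * r) powr p < (real j * s) powr p" "(diagonal p * r) powr p < (real k * inverse s) powr p"
    using g diagonal_bounds[OF p] r p by (intro powr_less_mono2; simp)+
  then show False using jk unfolding h ellipse_points_def by auto
qed

lemma ellipse_points_square:
  assumes r: "0 < r" and s: "0 < s" and jk: "1 \<le> j" "1 \<le> k"
    "real j \<le> diagonal p * (r / s)" "real k \<le> diagonal p * (r * s)"
  shows "(j, k) \<in> ellipse_points p r s"
proof -
  have h: "(diagonal p * r) powr p = r powr p / 2"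
    using diagonal_bounds[OF p] r by (simp add: powr_mult)
  have g: "real j * s \<le> diagonal p * r" "real k * inverse s \<le> diagonal p * r"
    using jk r s by (auto simp: field_simps)
  have "(real j * s) powr p \<le> (diagonal p * r) powr p" "(real k * inverse s) powr p \<le> (diagonal p * r) powr p"
    using g s p by (intro powr_mono2; simp)+
  then show ?thesis using jk unfolding h ellipse_points_def by auto
qed

text \<open>Columns up to the diagonal point together with rows up to it cover the ellipse, and they overlap in a full rectangle of lattice
points. Rows are columns of the ellipse with the inverse stretch.\<close>

lemma lattice_count_split:
  assumes r: "0 < r" and s: "0 < s"
  shows "real (lattice_count p r s) = column_sum p r s + column_sum p r (1 / s)
     - of_int \<lfloor>diagonal p * (r / s)\<rfloor> * of_int \<lfloor>diagonal p * (r * s)\<rfloor>"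
proof -
  define n m where "n = nat \<lfloor>diagonal p * (r / s)\<rfloor>" and "m = nat \<lfloor>diagonal p * (r * s)\<rfloor>"
  note c = diagonal_bounds[OF p]
  have pos: "0 < diagonal p * (r / s)" "0 < diagonal p * (r * s)" using c r s by auto
  have n: "real j \<le> diagonal p * (r / s) \<longleftrightarrow> j \<le> n" for j :: nat
    using pos unfolding n_def by (simp add: le_nat_iff le_floor_iff)
  have m: "real k \<le> diagonal p * (r * s) \<longleftrightarrow> k \<le> m" for k :: nat
    using pos unfolding m_def by (simp add: le_nat_iff le_floor_iff)
  define E where "E = ellipse_points p r s"
  define A where "A = {(j, k) \<in> E. j \<le> n}"
  define B where "B = {(j, k) \<in> E. k \<le> m}"
  have fin: "finite E" unfolding E_def using finite_ellipse_points p r s by simp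
  have E: "E = A \<union> B"
    using ellipse_points_near_axis[OF r s] n m by (auto simp: A_def B_def E_def)
  have "A \<inter> B = {0<..n} \<times> {0<..m}"
  proof (intro set_eqI)
    fix q :: "nat \<times> nat"
    obtain j k where q: "q = (j, k)" by fastforce
    show "q \<in> A \<inter> B \<longleftrightarrow> q \<in> {0<..n} \<times> {0<..m}"
      using ellipse_points_square[OF r s, of j k] n[of j] m[of k]
      by (auto simp: q A_def B_def E_def ellipse_points_def)
  qed
  then have AB: "card (A \<inter> B) = n * m" by simp
  have "finite A" "finite B" using fin by (auto simp: A_def B_def intro: finite_subset[of _ E])
  from card_Un_Int[OF this] have "card E + n * m = card A + card B" unfolding E AB by simp
  then have tot: "real (card E) = real (card A) + real (card B) - real n * real m"
    by (metis add_diff_cancel_right' of_nat_add of_nat_mult)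
  have lt: "diagonal p * x \<le> x" if "0 < x" for x using c that by simp
  have "real n \<le> r / s" using n[of n] lt[of "r / s"] r s by simp
  from ellipse_points_columns(2)[OF r s this] have A: "real (card A) = column_sum p r s"
    by (simp add: A_def E_def column_sum_def n_def)
  have "real m \<le> r * s" using m[of m] lt[OF mult_pos_pos[OF r s]] by linarith
  then have "real m \<le> r / (1 / s)" by simp
  from ellipse_points_columns(2)[OF r _ this] s
  have "real (card {(j, k) \<in> ellipse_points p r (1 / s). j \<le> m}) = column_sum p r (1 / s)"
    by (simp add: column_sum_def m_def)
  moreover have "{(j, k) \<in> ellipse_points p r (1 / s). j \<le> m} = prod.swap ` B"
    unfolding ellipse_points_swap[OF s] by (auto simp: B_def E_def image_iff)
  moreover have "card (prod.swap ` B) = card B" by (intro card_image) auto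
  ultimately have B: "real (card B) = column_sum p r (1 / s)" by simp
  have "real n = of_int \<lfloor>diagonal p * (r / s)\<rfloor>" "real m = of_int \<lfloor>diagonal p * (r * s)\<rfloor>"
    using pos by (auto simp: n_def m_def)
  then show ?thesis using tot A B by (simp add: lattice_count_def E_def)
qed

text \<open>Two column sums and the rectangle are combined. The oscillating terms \<open>frac X * Y\<close> and \<open>frac Y * X\<close>, which are of order \<open>r\<close>, cancel
against those in the product of the integer parts of \<open>X\<close> and \<open>Y\<close>.\<close>

lemma lattice_count_asymptotic:
  assumes K: "1 \<le> K"
  obtains C where "0 < C"
    "\<And>r s. 1 \<le> r \<Longrightarrow> 1 / K \<le> s \<Longrightarrow> s \<le> K \<Longrightarrow>
      \<bar>real (lattice_count p r s) - (r\<^sup>2 * arc_area p 1 - r * (s + 1 / s) / 2)\<bar>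
        \<le> C * r powr error_exponent p"
proof -
  obtain D where D: "0 < D" and col: "\<And>r s. 1 \<le> r \<Longrightarrow> 1 / K \<le> s \<Longrightarrow> s \<le> K \<Longrightarrow>
      \<bar>column_sum p r s - (r\<^sup>2 * arc_area p (diagonal p)
          - frac (diagonal p * (r / s)) * (diagonal p * (r * s))
          + (diagonal p * (r * s) - r * s) / 2 - diagonal p * (r / s) / 2)\<bar>
        \<le> D * r powr error_exponent p"
    using column_sum_asymptotic[OF p K] by blast
  show ?thesis
  proof (rule that[of "2 * D + 1"])
    show "0 < 2 * D + 1" using D by simp
    fix r s :: real
    assume r: "1 \<le> r" and s: "1 / K \<le> s" "s \<le> K"
    have s0: "0 < s" using s K by (smt (verit) divide_pos_pos)
    have r0: "0 < r" using r by simp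
    have s': "1 / K \<le> 1 / s" "1 / s \<le> K" using s s0 K by (auto simp: field_simps)
    define X Y where "X = diagonal p * (r / s)" and "Y = diagonal p * (r * s)"
    define B where "B = r\<^sup>2 * arc_area p (diagonal p)"
    have 1: "\<bar>column_sum p r s - (B - frac X * Y + (Y - r * s) / 2 - X / 2)\<bar> \<le> D * r powr error_exponent p"
      using col[OF r s] by (simp only: B_def X_def Y_def)
    have 2: "\<bar>column_sum p r (1 / s) - (B - frac Y * X + (X - r / s) / 2 - Y / 2)\<bar> \<le> D * r powr error_exponent p"
      using col[OF r s'] by (simp add: B_def X_def Y_def)
    have XY: "X * Y = r\<^sup>2 * (diagonal p)\<^sup>2" using s0 by (simp add: X_def Y_def power2_eq_square)
    have fl: "of_int \<lfloor>X\<rfloor> * of_int \<lfloor>Y\<rfloor> = X * Y - frac X * Y - frac Y * X + frac X * frac Y"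
      by (simp add: frac_def algebra_simps)
    have ff: "0 \<le> frac X * frac Y" "frac X * frac Y \<le> 1"
      using mult_mono[of "frac X" 1 "frac Y" 1] frac_lt_1[of X] frac_lt_1[of Y] by auto
    have N: "real (lattice_count p r s) = column_sum p r s + column_sum p r (1 / s)
        - (X * Y - frac X * Y - frac Y * X + frac X * frac Y)"
      using lattice_count_split[OF r0 s0] fl by (simp add: X_def Y_def)
    have A: "r\<^sup>2 * arc_area p 1 = 2 * B - X * Y"
      unfolding arc_area_symmetry[OF p] XY B_def by (simp add: algebra_simps)
    have rs: "r * (s + 1 / s) / 2 = r * s / 2 + r / s / 2" by (simp add: algebra_simps add_divide_distrib)
    have one: "1 \<le> r powr error_exponent p"
      using r error_exponent_ge(1)[OF p] by (intro ge_one_powr_ge_zero) auto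
    define E1 E2 where "E1 = column_sum p r s - (B - frac X * Y + (Y - r * s) / 2 - X / 2)"
      and "E2 = column_sum p r (1 / s) - (B - frac Y * X + (X - r / s) / 2 - Y / 2)"
    have "real (lattice_count p r s) - (r\<^sup>2 * arc_area p 1 - r * (s + 1 / s) / 2) = E1 + E2 - frac X * frac Y"
      unfolding N A rs E1_def E2_def by (simp add: diff_divide_distrib)
    moreover have "\<bar>E1\<bar> \<le> D * r powr error_exponent p" "\<bar>E2\<bar> \<le> D * r powr error_exponent p"
      using 1 2 by (auto simp: E1_def E2_def)
    ultimately have "\<bar>real (lattice_count p r s) - (r\<^sup>2 * arc_area p 1 - r * (s + 1 / s) / 2)\<bar>
       \<le> D * r powr error_exponent p + D * r powr error_exponent p + r powr error_exponent p"
      using ff one by linarith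
    then show "\<bar>real (lattice_count p r s) - (r\<^sup>2 * arc_area p 1 - r * (s + 1 / s) / 2)\<bar>
       \<le> (2 * D + 1) * r powr error_exponent p" by (simp add: algebra_simps)
  qed
qed

text \<open>All columns are used here, the last one being at least half way to the end of the ellipse, where the height has
dropped by the factor \<open>quarter_arc p (1/2) < 1\<close>. Hence the trapezoid deficit is at least a fixed multiple of \<open>r * s\<close>, for
stretches of any size, even comparable to \<open>r\<close>.\<close>

lemma lattice_count_elongated:
  assumes r: "0 < r" and s: "0 < s" and pos: "0 < lattice_count p r s"
  shows "real (lattice_count p r s) \<le> r\<^sup>2 * arc_area p 1 - r * s * (1 - quarter_arc p (1/2)) / 2"
proof -
  define N where "N = nat \<lfloor>r / s\<rfloor>"
  have rs: "0 < r / s" using r s by simp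
  have N: "real N \<le> r / s" "r / s < real N + 1" using rs unfolding N_def by linarith+
  have "{(j, k) \<in> ellipse_points p r s. j \<le> N} = ellipse_points p r s"
  proof -
    have "j \<le> N" if "(j, k) \<in> ellipse_points p r s" for j k
      using ellipse_point_bound[OF r s that] N by linarith
    then show ?thesis by auto
  qed
  then have cnt: "real (lattice_count p r s) = (\<Sum>j\<in>{0<..N}. of_int \<lfloor>r * s * quarter_arc p (real j * s / r)\<rfloor>)"
    using ellipse_points_columns(2)[OF r s N(1)] by (simp add: lattice_count_def)
  have N1: "1 \<le> N"
  proof (rule ccontr)
    assume "\<not> 1 \<le> N"
    then show False using cnt pos by simp
  qed
  have t: "1/2 \<le> real N * s / r" "real N * s / r \<le> 1"
  proof -
    have "r / s \<le> 2 * real N" using N N1 by linarith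
    then show "1/2 \<le> real N * s / r" using r s by (simp add: field_simps)
    show "real N * s / r \<le> 1" using N r s by (simp add: field_simps)
  qed
  have "real (lattice_count p r s) \<le> (\<Sum>j\<in>{0<..N}. r * s * quarter_arc p (real j * s / r))"
    unfolding cnt by (intro sum_mono) simp
  also have "\<dots> \<le> r\<^sup>2 * arc_area p (real N * s / r) - (r * s - r * s * quarter_arc p (real N * s / r)) / 2"
    by (rule column_heights_le[OF p r s N(1)])
  also have "\<dots> \<le> r\<^sup>2 * arc_area p 1 - (r * s - r * s * quarter_arc p (1/2)) / 2"
  proof -
    have "r\<^sup>2 * arc_area p (real N * s / r) \<le> r\<^sup>2 * arc_area p 1"
      using t order_trans[OF _ t(1), of 0] by (intro mult_left_mono arc_area_mono[OF p]) auto
    moreover have "r * s * quarter_arc p (real N * s / r) \<le> r * s * quarter_arc p (1/2)"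
      using t r s by (intro mult_left_mono arc_antimono[OF p]) auto
    ultimately show ?thesis by (intro diff_mono divide_right_mono) auto
  qed
  finally show ?thesis by (simp add: algebra_simps)
qed

lemma error_exponent_less_one: "error_exponent p < 1"
  using p by (simp add: error_exponent_def)

text \<open>Compared with the count \<open>A * r\<^sup>2 - r - o(r)\<close> of the circle, where \<open>A = arc_area p 1\<close>, stretches by \<open>4 / (1 - quarter_arc p (1/2))\<close>
or more fall short of \<open>A * r\<^sup>2\<close> by at least \<open>2 * r\<close>. Small stretches reduce to large ones by swapping the coordinates.\<close>

lemma optimal_stretch_bounded:
  obtains K r0 where "1 \<le> K" "1 \<le> r0"
    "\<And>r s. r0 \<le> r \<Longrightarrow> s \<in> optimal_stretches p r \<Longrightarrow> 0 < s \<and> 1 / K \<le> s \<and> s \<le> K"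
proof -
  define \<delta> where "\<delta> = 1 - quarter_arc p (1/2)"
  have \<delta>: "0 < \<delta>" using arc_half_less_one[OF p] by (simp add: \<delta>_def)
  define K where "K = max 1 (4 / \<delta>)"
  obtain C where C: "0 < C" and asym: "\<And>r s. 1 \<le> r \<Longrightarrow> 1 / 1 \<le> s \<Longrightarrow> s \<le> 1 \<Longrightarrow>
      \<bar>real (lattice_count p r s) - (r\<^sup>2 * arc_area p 1 - r * (s + 1 / s) / 2)\<bar>
        \<le> C * r powr error_exponent p"
    using lattice_count_asymptotic[of 1] by blast
  define e where "e = 1 - error_exponent p"
  have e: "0 < e" using error_exponent_less_one by (simp add: e_def)
  \<comment> \<open>The first bound puts the point \<open>(1, 1)\<close> into the circle, so that the optimal count is positive; the second makes the error term smaller than \<open>r\<close>.\<close>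
  define r0 where "r0 = max 2 ((2 * C) powr (1 / e))"
  show ?thesis
  proof (rule that[of K r0])
    show "1 \<le> K" "1 \<le> r0" by (auto simp: K_def r0_def)
    fix r s assume r: "r0 \<le> r" and opt: "s \<in> optimal_stretches p r"
    have r2: "2 \<le> r" "(2 * C) powr (1 / e) \<le> r" using r by (auto simp: r0_def)
    have s0: "0 < s" and max: "lattice_count p r 1 \<le> lattice_count p r s"
      using opt by (auto simp: optimal_stretches_def is_arg_max_linorder)
    have small: "C * r powr error_exponent p < r"
    proof -
      have "((2 * C) powr (1 / e)) powr e \<le> r powr e" using r2 e by (intro powr_mono2) auto
      then have "2 * C \<le> r powr e" using e C by (simp add: powr_powr)
      then have "C < r powr e" using C by simp
      then have "C * r powr error_exponent p < r powr e * r powr error_exponent p"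
        using r2 by (intro mult_strict_right_mono) auto
      also have "\<dots> = r" using r2 by (simp add: e_def powr_add[symmetric])
      finally show ?thesis .
    qed
    have low: "r\<^sup>2 * arc_area p 1 - 2 * r < real (lattice_count p r 1)"
      using asym[of r 1] r2 small by simp
    have "(1, 1) \<in> ellipse_points p r 1"
    proof -
      have "r powr 1 \<le> r powr p" using r2 p by (intro powr_mono) auto
      then show ?thesis using r2 by (simp add: ellipse_points_def)
    qed
    then have "0 < lattice_count p r 1"
      using finite_ellipse_points[of p r 1] p r2 unfolding lattice_count_def by (auto simp: card_gt_0_iff)
    then have pos: "0 < lattice_count p r s" using max by simp
    have bound: "t \<le> K" if t: "0 < t" "lattice_count p r t = lattice_count p r s" for t
    proof (rule ccontr)
      assume "\<not> t \<le> K"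
      then have "4 / \<delta> \<le> t" by (simp add: K_def)
      then have "4 \<le> t * \<delta>" using \<delta> by (simp add: field_simps)
      then have "r * 4 \<le> r * (t * \<delta>)" using r2 by (intro mult_left_mono) auto
      moreover have "real (lattice_count p r t) \<le> r\<^sup>2 * arc_area p 1 - r * t * \<delta> / 2"
        unfolding \<delta>_def using t pos r2 by (intro lattice_count_elongated) auto
      ultimately have "real (lattice_count p r t) \<le> r\<^sup>2 * arc_area p 1 - 2 * r" by (simp add: mult.assoc)
      then show False using low max t by simp
    qed
    have "s \<le> K" using bound[of s] s0 by simp
    moreover have "1 / s \<le> K" using bound[of "1 / s"] lattice_count_inverse[OF s0] s0 by simp
    ultimately show "0 < s \<and> 1 / K \<le> s \<and> s \<le> K"
      using s0 by (auto simp: K_def field_simps)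
  qed
qed

end

theorem mainTheorem4:
  fixes p :: real
  assumes "1 < p"
  shows "\<exists>C>0. \<exists>r0>0. \<forall>r\<ge>r0. \<forall>s\<in>optimal_stretches p r.
           \<bar>s - 1\<bar> \<le> C * r powr (- min (1/6) (1/(2*p)))"
proof -
  obtain K r0 where K: "1 \<le> K" and r0: "1 \<le> r0" and bounded:
    "\<And>r s. r0 \<le> r \<Longrightarrow> s \<in> optimal_stretches p r \<Longrightarrow> 0 < s \<and> 1 / K \<le> s \<and> s \<le> K"
    using optimal_stretch_bounded[OF assms] by blast
  obtain C where C: "0 < C" and asym: "\<And>r s. 1 \<le> r \<Longrightarrow> 1 / K \<le> s \<Longrightarrow> s \<le> K \<Longrightarrow>
      \<bar>real (lattice_count p r s) - (r\<^sup>2 * arc_area p 1 - r * (s + 1 / s) / 2)\<bar>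
        \<le> C * r powr error_exponent p"
    using lattice_count_asymptotic[OF assms K] by blast
  define e where "e = min (1/6) (1/(2*p))"
  have ee: "error_exponent p - 1 = - (2 * e)"
    using assms by (auto simp: error_exponent_def e_def min_def max_def field_simps)
  have "\<bar>s - 1\<bar> \<le> sqrt (4 * C * K) * r powr (- e)"
    if r: "r0 \<le> r" and opt: "s \<in> optimal_stretches p r" for r s
  proof -
    have r1: "1 \<le> r" using r r0 by simp
    have s: "0 < s" "1 / K \<le> s" "s \<le> K" using bounded[OF r opt] by auto
    have "lattice_count p r 1 \<le> lattice_count p r s"
      using opt by (auto simp: optimal_stretches_def is_arg_max_linorder)
    then have "real (lattice_count p r 1) \<le> real (lattice_count p r s)" by simp
    moreover have "\<bar>real (lattice_count p r 1) - (r\<^sup>2 * arc_area p 1 - r)\<bar> \<le> C * r powr error_exponent p"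
      using asym[of r 1] r1 K by simp
    ultimately have "r * (s + 1 / s) / 2 - r \<le> 2 * (C * r powr error_exponent p)"
      using asym[OF r1 s(2,3)] by linarith
    then have "r * (s + 1 / s - 2) \<le> 4 * C * r powr error_exponent p" by (simp add: algebra_simps)
    also have "\<dots> = r * (4 * C * r powr (- (2 * e)))"
      using r1 by (simp add: ee[symmetric] powr_diff)
    finally have *: "s + 1 / s - 2 \<le> 4 * C * r powr (- (2 * e))" using r1 by simp
    have "s * (s + 1 / s - 2) \<le> K * (4 * C * r powr (- (2 * e)))"
    proof -
      have "s * (s + 1 / s - 2) \<le> s * (4 * C * r powr (- (2 * e)))" using * s by (intro mult_left_mono) auto
      also have "\<dots> \<le> K * (4 * C * r powr (- (2 * e)))" using s C by (intro mult_right_mono) auto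
      finally show ?thesis .
    qed
    moreover have "s * (s + 1 / s - 2) = (s - 1)\<^sup>2" using s by (simp add: power2_eq_square field_simps)
    moreover have "r powr (- (2 * e)) = (r powr (- e))\<^sup>2"
      by (simp add: power2_eq_square powr_add[symmetric])
    ultimately have "(s - 1)\<^sup>2 \<le> 4 * C * K * (r powr (- e))\<^sup>2" by (simp add: mult_ac)
    then have "sqrt ((s - 1)\<^sup>2) \<le> sqrt (4 * C * K * (r powr (- e))\<^sup>2)" by (rule real_sqrt_le_mono)
    then show ?thesis by (simp add: real_sqrt_mult)
  qed
  moreover have "0 < sqrt (4 * C * K)" using C K by simp
  moreover have "0 < r0" using r0 by simp
  ultimately show ?thesis unfolding e_def by blast
qed

end
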